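(* The triple $(\mathscr{C},c,\varepsilon)$ is a comonad on the category $\mathbf{C}$ of proximity frames and proximity-preserving frame homomorphisms, with counit $\varepsilon:\mathscr{C}\to 1$ and comultiplication $c:\mathscr{C}\to\mathscr{C}\mathscr{C}$.
   Context: A proximity on a frame $L$ is a binary relation $\prec$ on $L$ such that: (1) $a\prec b$ implies $a\le b$, and $\prec$ is a (bounded) sublattice of $L\times L$, i.e. $0\prec 0$, $1\prec 1$, and $a_1\prec b_1$, $a_2\prec b_2$ imply $a_1\wedge a_2\prec b_1\wedge b_2$ and $a_1\vee a_2\prec b_1\vee b_2$; (2) $a\le b\prec c\le d$ implies $a\prec d$; (3) $a\prec b$ implies $a\prec c\prec b$ for some $c$; (4) $a=\bigvee\{b\mid b\prec a\}$ for all $a\in L$. The pair $(L,\prec)$ is a proximity frame. $\mathbf{C}$ is the category of proximity frames and frame homomorphisms that preserve the proximities ($a\prec b\Rightarrow f(a)\prec f(b)$). An ideal of $L$ is a downset closed under finite joins (in particular it contains $0$). An ideal $I$ is round if for each $a\in I$ there is $b\in I$ with $a\prec b$. $\mathfrak{R}L$ is the frame of round ideals of $(L,\prec)$ ordered by inclusion (a subframe of the frame of ideals of $L$). For a meet-semilattice homomorphism $f:L\to M$ between proximity frames, $\mathfrak{R}f:\mathfrak{R}L\to\mathfrak{R}M$ is $\mathfrak{R}f(I)=\{a\in M\mid a\prec f(b)\text{ for some }b\in I\}$. $\kappa_L:L\to\mathfrak{R}L$ is $\kappa_L(a)=\{b\mid b\prec a\}$. For a proximity frame $L$, $\mathscr{C}L=(\mathfrak{R}L,\sqsubseteq)$,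 where $I\sqsubseteq J$ iff $I\subseteq J$ and $I\ll\kappa_L(\bigvee J)$ in $\mathfrak{R}L$ ($\ll$ the way-below relation of $\mathfrak{R}L$); equivalently, $I\subseteq J$ and $\bigvee I\prec\bigvee J$. This is a proximity on $\mathfrak{R}L$. For a morphism $f$ of $\mathbf{C}$, $\mathscr{C}f$ is $\mathfrak{R}f$ as a map $(\mathfrak{R}L,\sqsubseteq)\to(\mathfrak{R}M,\sqsubseteq)$; this makes $\mathscr{C}$ an endofunctor on $\mathbf{C}$. $\varepsilon_L:\mathscr{C}L\to L$ is $\varepsilon_L(I)=\bigvee I$. The map $c_L:\mathscr{C}L\to\mathscr{C}\mathscr{C}L$ is obtained by applying $\mathfrak{R}$ to $\kappa_L$ viewed as a map $L\to(\mathfrak{R}L,\sqsubseteq)$, i.e. $c_L(I)=\{K\in\mathfrak{R}L\mid K\sqsubseteq\kappa_L(a)\text{ for some }a\in I\}=\{K\in\mathfrak{R}L\mid \bigvee K\in I\}$. A comonad $(T,\delta,\epsilon)$ consists of an endofunctor $T$ and natural transformations $\delta:T\to TT$, $\epsilon:T\to1$ with $T\delta\cdot\delta=\delta T\cdot\delta$ and $\epsilon T\cdot\delta=T\epsilon\cdot\delta=1_T$. *)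

theory Defs
  imports "HOL-Algebra.Complete_Lattice" "HOL-Library.FuncSet"
begin

locale frame = complete_lattice L for L (structure) +
  assumes meet_Sup_distrib:
    "\<lbrakk>a \<in> carrier L; B \<subseteq> carrier L\<rbrakk> \<Longrightarrow> a \<sqinter> \<Squnion>B = \<Squnion>((\<lambda>b. a \<sqinter> b) ` B)"

record 'a prox_frame = "'a gorder" +
  prox :: "'a \<Rightarrow> 'a \<Rightarrow> bool" (infixl \<open>\<prec>\<index>\<close> 50)

locale proximity_frame = frame L for L :: "'a prox_frame" (structure) +
  assumes prox_carrier: "a \<prec> b \<Longrightarrow> a \<in> carrier L \<and> b \<in> carrier L"
    and prox_le: "a \<prec> b \<Longrightarrow> a \<sqsubseteq> b"
    and prox_bottom: "\<bottom> \<prec> \<bottom>"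
    and prox_top: "\<top> \<prec> \<top>"
    and prox_meet: "\<lbrakk>a1 \<prec> b1; a2 \<prec> b2\<rbrakk> \<Longrightarrow> a1 \<sqinter> a2 \<prec> b1 \<sqinter> b2"
    and prox_join: "\<lbrakk>a1 \<prec> b1; a2 \<prec> b2\<rbrakk> \<Longrightarrow> a1 \<squnion> a2 \<prec> b1 \<squnion> b2"
    and prox_mono:
      "\<lbrakk>a \<in> carrier L; d \<in> carrier L; a \<sqsubseteq> b; b \<prec> c; c \<sqsubseteq> d\<rbrakk> \<Longrightarrow> a \<prec> d"
    and prox_interpolate: "a \<prec> b \<Longrightarrow> \<exists>c. a \<prec> c \<and> c \<prec> b"
    and prox_approx: "a \<in> carrier L \<Longrightarrow> a = \<Squnion>{b. b \<prec> a}"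

text \<open>
  The category of proximity frames. Morphisms are functions that are extensional on the carrier
  of their domain, so that equality of morphisms is equality in HOL.
\<close>

definition pf_hom :: "'a prox_frame \<Rightarrow> 'b prox_frame \<Rightarrow> ('a \<Rightarrow> 'b) set" where
  "pf_hom L M = {f \<in> carrier L \<rightarrow>\<^sub>E carrier M.
     f \<top>\<^bsub>L\<^esub> = \<top>\<^bsub>M\<^esub> \<and>
     (\<forall>a\<in>carrier L. \<forall>b\<in>carrier L. f (a \<sqinter>\<^bsub>L\<^esub> b) = f a \<sqinter>\<^bsub>M\<^esub> f b) \<and>
     (\<forall>A. A \<subseteq> carrier L \<longrightarrow> f (\<Squnion>\<^bsub>L\<^esub> A) = \<Squnion>\<^bsub>M\<^esub> (f ` A)) \<and>
     (\<forall>a b. a \<prec>\<^bsub>L\<^esub> b \<longrightarrow> f a \<prec>\<^bsub>M\<^esub> f b)}"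

definition pf_id :: "'a prox_frame \<Rightarrow> 'a \<Rightarrow> 'a" where
  "pf_id L = (\<lambda>x\<in>carrier L. x)"

definition pf_comp :: "'a prox_frame \<Rightarrow> ('b \<Rightarrow> 'c) \<Rightarrow> ('a \<Rightarrow> 'b) \<Rightarrow> 'a \<Rightarrow> 'c" where
  "pf_comp L g f = compose (carrier L) g f"

definition order_ideal :: "('a, 'm) gorder_scheme \<Rightarrow> 'a set \<Rightarrow> bool" where
  "order_ideal L I \<longleftrightarrow> I \<subseteq> carrier L \<and> \<bottom>\<^bsub>L\<^esub> \<in> I \<and>
     (\<forall>a\<in>I. \<forall>b\<in>I. a \<squnion>\<^bsub>L\<^esub> b \<in> I) \<and>
     (\<forall>a\<in>I. \<forall>b\<in>carrier L. b \<sqsubseteq>\<^bsub>L\<^esub> a \<longrightarrow> b \<in> I)"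

definition round_ideal :: "'a prox_frame \<Rightarrow> 'a set \<Rightarrow> bool" where
  "round_ideal L I \<longleftrightarrow> order_ideal L I \<and> (\<forall>a\<in>I. \<exists>b\<in>I. a \<prec>\<^bsub>L\<^esub> b)"

definition round_ideals :: "'a prox_frame \<Rightarrow> 'a set gorder" (\<open>\<RR>\<close>) where
  "\<RR> L = \<lparr>carrier = {I. round_ideal L I}, eq = (=), le = (\<subseteq>)\<rparr>"

definition directed_subset :: "('a, 'm) gorder_scheme \<Rightarrow> 'a set \<Rightarrow> bool" where
  "directed_subset P D \<longleftrightarrow> D \<subseteq> carrier P \<and> D \<noteq> {} \<and>
     (\<forall>x\<in>D. \<forall>y\<in>D. \<exists>z\<in>D. x \<sqsubseteq>\<^bsub>P\<^esub> z \<and> y \<sqsubseteq>\<^bsub>P\<^esub> z)"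

definition way_below :: "('a, 'm) gorder_scheme \<Rightarrow> 'a \<Rightarrow> 'a \<Rightarrow> bool" where
  "way_below P x y \<longleftrightarrow> x \<in> carrier P \<and> y \<in> carrier P \<and>
     (\<forall>D. directed_subset P D \<and> y \<sqsubseteq>\<^bsub>P\<^esub> \<Squnion>\<^bsub>P\<^esub> D \<longrightarrow> (\<exists>d\<in>D. x \<sqsubseteq>\<^bsub>P\<^esub> d))"

definition kappa :: "'a prox_frame \<Rightarrow> 'a \<Rightarrow> 'a set" (\<open>\<kappa>\<close>) where
  "\<kappa> L = (\<lambda>a\<in>carrier L. {b \<in> carrier L. b \<prec>\<^bsub>L\<^esub> a})"

text \<open>
  The action of \<open>\<RR>\<close> on maps; only the proximity of the codomain enters. It is stated for
  arbitrary functions, because it is also applied to \<^const>\<open>kappa\<close>, which is a meet-semilattice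
  homomorphism but in general not a frame homomorphism.
\<close>

definition round_map :: "'a prox_frame \<Rightarrow> 'b prox_frame \<Rightarrow> ('a \<Rightarrow> 'b) \<Rightarrow> 'a set \<Rightarrow> 'b set" where
  "round_map L M f = (\<lambda>I\<in>carrier (\<RR> L). {a \<in> carrier M. \<exists>b\<in>I. a \<prec>\<^bsub>M\<^esub> f b})"

definition C_obj :: "'a prox_frame \<Rightarrow> 'a set prox_frame" (\<open>\<C>\<close>) where
  "\<C> L = \<lparr>carrier = carrier (\<RR> L), eq = (=), le = (\<subseteq>),
     prox = (\<lambda>I J. I \<in> carrier (\<RR> L) \<and> J \<in> carrier (\<RR> L) \<and>
       I \<subseteq> J \<and> way_below (\<RR> L) I (\<kappa> L (\<Squnion>\<^bsub>L\<^esub> J)))\<rparr>"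

definition C_map :: "'a prox_frame \<Rightarrow> 'b prox_frame \<Rightarrow> ('a \<Rightarrow> 'b) \<Rightarrow> 'a set \<Rightarrow> 'b set" where
  "C_map L M f = round_map L M f"

definition counit :: "'a prox_frame \<Rightarrow> 'a set \<Rightarrow> 'a" where
  "counit L = (\<lambda>I\<in>carrier (\<C> L). \<Squnion>\<^bsub>L\<^esub> I)"

definition comult :: "'a prox_frame \<Rightarrow> 'a set \<Rightarrow> 'a set set" where
  "comult L = round_map L (\<C> L) (\<kappa> L)"

lemma pf_id_hom:
  assumes "proximity_frame L"
  shows "pf_id L \<in> pf_hom L L"
proof -
  interpret proximity_frame L by fact
  have img: "pf_id L ` A = A" if "A \<subseteq> carrier L" for A
    using that by (auto simp: pf_id_def image_iff subset_iff)
  show ?thesis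
    by (auto simp: pf_hom_def img dest: prox_carrier) (auto simp: pf_id_def dest: prox_carrier)
qed

lemma pf_comp_hom:
  assumes "proximity_frame L" "f \<in> pf_hom L M" "g \<in> pf_hom M N"
  shows "pf_comp L g f \<in> pf_hom L N"
proof -
  interpret proximity_frame L by fact
  have f: "f x \<in> carrier M" if "x \<in> carrier L" for x
    using assms(2) that by (auto simp: pf_hom_def)
  have g: "g x \<in> carrier N" if "x \<in> carrier M" for x
    using assms(3) that by (auto simp: pf_hom_def)
  have img: "pf_comp L g f ` A = g ` f ` A" if "A \<subseteq> carrier L" for A
    using that by (force simp: pf_comp_def compose_def image_iff)
  have fsub: "f ` A \<subseteq> carrier M" if "A \<subseteq> carrier L" for A
    using f that by auto
  have app: "pf_comp L g f x = g (f x)" if "x \<in> carrier L" for x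
    using that by (simp add: pf_comp_def compose_def)
  have "pf_comp L g f \<in> carrier L \<rightarrow>\<^sub>E carrier N"
    using f g by (auto simp: pf_comp_def compose_def)
  moreover have "pf_comp L g f (\<Squnion>\<^bsub>L\<^esub> A) = \<Squnion>\<^bsub>N\<^esub> (pf_comp L g f ` A)" if "A \<subseteq> carrier L" for A
    using that assms(2,3) fsub by (simp add: app img pf_hom_def)
  moreover have "pf_comp L g f a \<prec>\<^bsub>N\<^esub> pf_comp L g f b" if "a \<prec>\<^bsub>L\<^esub> b" for a b
    using that assms(2,3) prox_carrier[OF that] by (simp add: app pf_hom_def)
  moreover have "pf_comp L g f \<top>\<^bsub>L\<^esub> = \<top>\<^bsub>N\<^esub>"
    using assms(2,3) by (simp add: app pf_hom_def)
  moreover have "pf_comp L g f (a \<sqinter>\<^bsub>L\<^esub> b) = pf_comp L g f a \<sqinter>\<^bsub>N\<^esub> pf_comp L g f b"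
    if "a \<in> carrier L" "b \<in> carrier L" for a b
    using that assms(2,3) f by (simp add: app pf_hom_def)
  ultimately show ?thesis
    by (simp add: pf_hom_def)
qed

end

theory Submission
  imports Defs
begin

text \<open>
  For round ideals one has \<open>I \<sqsubseteq> J\<close> iff \<open>I \<subseteq> J\<close> and \<open>\<Squnion>I \<prec> \<Squnion>J\<close>, because \<open>\<kappa> a\<close> is the directed union of
  the \<open>\<kappa> b\<close> with \<open>b \<prec> a\<close>. As \<open>I \<mapsto> \<Squnion>I\<close> preserves finite meets and arbitrary joins, the axioms of a
  proximity carry over from \<open>L\<close>; \<open>J \<inter> \<kappa> c\<close> interpolates between \<open>I\<close> and \<open>J\<close> if \<open>c\<close> interpolates
  between \<open>\<Squnion>I\<close> and \<open>\<Squnion>J\<close>. On a morphism \<open>f\<close> the functor sends \<open>I\<close> to the downset generated by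
  \<open>f ` I\<close>, and the comultiplication is \<open>I \<mapsto> {K. \<Squnion>K \<in> I}\<close>. With these descriptions naturality and
  the comonad laws are computations in which roundness supplies the ideals \<open>\<kappa> a\<close> for \<open>a \<in> I\<close>.
\<close>

section \<open>Round ideals and the ideal generated by a family of ideals\<close>

text \<open>Inductive generation lets computations with joins of ideals go by rule induction, one
  case for each closure property of an ideal. The rule \<open>span_bottom\<close> gives the empty
  family the least ideal as its span.\<close>

inductive_set ideal_span :: "('a, 'm) gorder_scheme \<Rightarrow> 'a set set \<Rightarrow> 'a set" for L A where
  span_bottom: "\<bottom>\<^bsub>L\<^esub> \<in> ideal_span L A"
| span_base: "\<lbrakk>I \<in> A; x \<in> I\<rbrakk> \<Longrightarrow> x \<in> ideal_span L A"
| span_join: "\<lbrakk>x \<in> ideal_span L A; y \<in> ideal_span L A\<rbrakk> \<Longrightarrow> x \<squnion>\<^bsub>L\<^esub> y \<in> ideal_span L A"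
| span_down: "\<lbrakk>x \<in> ideal_span L A; y \<in> carrier L; y \<sqsubseteq>\<^bsub>L\<^esub> x\<rbrakk> \<Longrightarrow> y \<in> ideal_span L A"

lemma round_idealI:
  assumes "\<And>x. x \<in> I \<Longrightarrow> x \<in> carrier L" "\<bottom>\<^bsub>L\<^esub> \<in> I"
    "\<And>x y. \<lbrakk>x \<in> I; y \<in> I\<rbrakk> \<Longrightarrow> x \<squnion>\<^bsub>L\<^esub> y \<in> I"
    "\<And>x y. \<lbrakk>x \<in> I; y \<in> carrier L; y \<sqsubseteq>\<^bsub>L\<^esub> x\<rbrakk> \<Longrightarrow> y \<in> I"
    "\<And>x. x \<in> I \<Longrightarrow> \<exists>y\<in>I. x \<prec>\<^bsub>L\<^esub> y"
  shows "round_ideal L I"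
  unfolding round_ideal_def order_ideal_def
  by (intro conjI ballI impI subsetI) (rule assms; assumption)+

lemma round_ideal_carrier: "\<lbrakk>round_ideal L I; x \<in> I\<rbrakk> \<Longrightarrow> x \<in> carrier L"
  and round_ideal_subset: "round_ideal L I \<Longrightarrow> I \<subseteq> carrier L"
  and round_ideal_bottom: "round_ideal L I \<Longrightarrow> \<bottom>\<^bsub>L\<^esub> \<in> I"
  and round_ideal_join: "\<lbrakk>round_ideal L I; x \<in> I; y \<in> I\<rbrakk> \<Longrightarrow> x \<squnion>\<^bsub>L\<^esub> y \<in> I"
  and round_ideal_down: "\<lbrakk>round_ideal L I; x \<in> I; y \<in> carrier L; y \<sqsubseteq>\<^bsub>L\<^esub> x\<rbrakk> \<Longrightarrow> y \<in> I"
  and round_ideal_round: "\<lbrakk>round_ideal L I; x \<in> I\<rbrakk> \<Longrightarrow> \<exists>y\<in>I. x \<prec>\<^bsub>L\<^esub> y"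
  by (auto simp: round_ideal_def order_ideal_def)

lemma C_carrier [simp]: "carrier (\<C> L) = {I. round_ideal L I}"
  and C_eq [simp]: "I .=\<^bsub>\<C> L\<^esub> J \<longleftrightarrow> I = J"
  and C_le [simp]: "I \<sqsubseteq>\<^bsub>\<C> L\<^esub> J \<longleftrightarrow> I \<subseteq> J"
  by (simp_all add: C_obj_def round_ideals_def)

text \<open>Suprema depend only on carrier and order, which \<open>\<RR> L\<close> and
  \<open>\<C> L\<close> share. So the way-below relation of \<open>\<RR> L\<close> can be studied
  with suprema taken in \<open>\<C> L\<close>.\<close>

lemma R_carrier: "carrier (\<RR> L) = {I. round_ideal L I}"
  and R_le: "I \<sqsubseteq>\<^bsub>\<RR> L\<^esub> J \<longleftrightarrow> I \<subseteq> J"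
  and R_sup: "\<Squnion>\<^bsub>\<RR> L\<^esub> A = \<Squnion>\<^bsub>\<C> L\<^esub> A"
  by (simp_all add: round_ideals_def sup_def least_def Upper_def)

lemma ideal_span_least:
  assumes "round_ideal L J" "\<And>I. I \<in> A \<Longrightarrow> I \<subseteq> J"
  shows "ideal_span L A \<subseteq> J"
proof
  fix x assume "x \<in> ideal_span L A"
  then show "x \<in> J"
    by induction (use assms in \<open>auto intro: round_ideal_bottom round_ideal_join round_ideal_down\<close>)
qed

lemma ideal_span_upper: "I \<in> A \<Longrightarrow> I \<subseteq> ideal_span L A"
  by (auto intro: span_base)

section \<open>Elementary facts on frames, proximities and the ideals
  \<open>\<kappa> L a\<close>\<close>

context frame
begin

lemma join_meet_distrib:
  assumes "x \<in> carrier L" "y \<in> carrier L" "z \<in> carrier L"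
  shows "z \<sqinter> (x \<squnion> y) = (z \<sqinter> x) \<squnion> (z \<sqinter> y)"
  using meet_Sup_distrib[of z "{x, y}"] assms by (simp add: join_def)

lemma Sup_eqI:
  assumes "A \<subseteq> carrier L" "s \<in> carrier L" "\<And>x. x \<in> A \<Longrightarrow> x \<sqsubseteq> s"
    "\<And>u. \<lbrakk>u \<in> carrier L; \<And>x. x \<in> A \<Longrightarrow> x \<sqsubseteq> u\<rbrakk> \<Longrightarrow> s \<sqsubseteq> u"
  shows "\<Squnion>A = s"
  using assms by (intro le_antisym sup_least assms(4)) (auto intro: sup_upper)

end

context proximity_frame
begin

lemma prox_le_trans: "\<lbrakk>a \<prec> b; b \<sqsubseteq> c; c \<in> carrier L\<rbrakk> \<Longrightarrow> a \<prec> c"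
  by (meson le_refl prox_carrier prox_mono)

lemma le_prox_trans: "\<lbrakk>a \<sqsubseteq> b; b \<prec> c; a \<in> carrier L\<rbrakk> \<Longrightarrow> a \<prec> c"
  by (meson le_refl prox_carrier prox_mono)

lemma prox_meet_same: "\<lbrakk>a \<prec> b; a \<prec> c\<rbrakk> \<Longrightarrow> a \<prec> b \<sqinter> c"
  using prox_meet[of a b a c] prox_carrier[of a b] by (simp add: meet_def)

lemma prox_join_same: "\<lbrakk>a \<prec> c; b \<prec> c\<rbrakk> \<Longrightarrow> a \<squnion> b \<prec> c"
  using prox_join[of a c b c] prox_carrier[of a c] by (simp add: join_def)

lemma kappa_eq: "a \<in> carrier L \<Longrightarrow> \<kappa> L a = {b. b \<prec> a}"
  by (auto simp: kappa_def dest: prox_carrier)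

lemma Sup_kappa: "a \<in> carrier L \<Longrightarrow> \<Squnion>(\<kappa> L a) = a"
  using prox_approx by (simp add: kappa_eq)

text \<open>Roundness is the interpolation axiom; the ideal properties come from
  \<open>prox_bottom\<close>, \<open>prox_join_same\<close> and
  \<open>le_prox_trans\<close>.\<close>

lemma round_ideal_kappa:
  assumes "a \<in> carrier L"
  shows "round_ideal L (\<kappa> L a)"
proof (rule round_idealI)
  show "\<bottom> \<in> \<kappa> L a"
    using assms prox_le_trans[OF prox_bottom] by (simp add: kappa_eq)
  show "\<exists>y\<in>\<kappa> L a. x \<prec> y" if "x \<in> \<kappa> L a" for x
    using that assms prox_interpolate by (auto simp: kappa_eq)
  show "y \<in> \<kappa> L a" if "x \<in> \<kappa> L a" "y \<in> carrier L" "y \<sqsubseteq> x" for x y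
    using that assms le_prox_trans[of y x a] by (simp add: kappa_eq)
  show "x \<in> carrier L" if "x \<in> \<kappa> L a" for x
    using that assms by (simp add: kappa_def)
  show "x \<squnion> y \<in> \<kappa> L a" if "x \<in> \<kappa> L a" "y \<in> \<kappa> L a" for x y
    using that assms prox_join_same by (simp add: kappa_eq)
qed

lemma meet_mem_Int:
  assumes "round_ideal L I" "round_ideal L J" "x \<in> I" "y \<in> J"
  shows "x \<sqinter> y \<in> I \<inter> J"
proof -
  have "x \<in> carrier L" "y \<in> carrier L"
    using assms by (simp_all add: round_ideal_carrier)
  then show ?thesis
    using assms round_ideal_down[of L I x "x \<sqinter> y"] round_ideal_down[of L J y "x \<sqinter> y"]
    by (simp add: meet_left meet_right)
qed

text \<open>Roundness: if \<open>x \<prec> y \<in> I\<close> and \<open>x \<prec> z \<in> J\<close>,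
  then \<open>y \<sqinter> z\<close> lies in both ideals and
  \<open>x \<prec> y \<sqinter> z\<close>.\<close>

lemma round_ideal_Int:
  assumes I: "round_ideal L I" and J: "round_ideal L J"
  shows "round_ideal L (I \<inter> J)"
proof (rule round_idealI)
  fix x assume "x \<in> I \<inter> J"
  then obtain y z where yz: "y \<in> I" "z \<in> J" "x \<prec> y" "x \<prec> z"
    using round_ideal_round[OF I] round_ideal_round[OF J] by blast
  have "y \<sqinter> z \<in> I \<inter> J"
    using I J yz(1,2) by (rule meet_mem_Int)
  then show "\<exists>w\<in>I \<inter> J. x \<prec> w"
    using prox_meet_same yz by blast
qed (use assms in \<open>auto dest: round_ideal_bottom round_ideal_join round_ideal_down round_ideal_carrier\<close>)

text \<open>Top is a roundness witness for every element, since
  \<open>x \<sqsubseteq> \<top>\<close> and \<open>\<top> \<prec> \<top>\<close>.\<close>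

lemma round_ideal_carrier_set: "round_ideal L (carrier L)"
  by (rule round_idealI) (auto intro!: bexI[of _ \<top>] prox_mono[OF _ _ _ prox_top])

lemma round_ideal_bottom_set: "round_ideal L {\<bottom>}"
proof (rule round_idealI)
  show "y \<in> {\<bottom>}" if "x \<in> {\<bottom>}" "y \<in> carrier L" "y \<sqsubseteq> x" for x y
    using that by (simp add: le_antisym)
qed (auto simp: join_def prox_bottom)

text \<open>Roundness survives each generating rule: by \<open>prox_bottom\<close>, by roundness of
  the members, by \<open>prox_join\<close>, and by \<open>le_prox_trans\<close>. Hence joins of
  round ideals can be formed as generated ideals.\<close>

lemma round_ideal_span:
  assumes A: "\<And>I. I \<in> A \<Longrightarrow> round_ideal L I"
  shows "round_ideal L (ideal_span L A)"
proof (rule round_idealI)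
  show carrier: "x \<in> carrier L" if "x \<in> ideal_span L A" for x
    using that by induction (use A in \<open>auto dest: round_ideal_carrier\<close>)
  show "\<exists>y\<in>ideal_span L A. x \<prec> y" if "x \<in> ideal_span L A" for x
    using that
  proof induction
    case (span_base I x)
    then show ?case
      using round_ideal_round[OF A] by (blast intro: ideal_span.span_base)
  next
    case (span_down x y)
    then show ?case
      by (meson le_prox_trans)
  qed (blast intro: prox_bottom prox_join ideal_span.intros)+
qed (auto intro: ideal_span.intros)

section \<open>The frame of round ideals\<close>

lemma partial_order_C: "partial_order (\<C> L)"
  by unfold_locales (auto simp: fun_eq_iff)

lemma is_lub_span:
  assumes "A \<subseteq> carrier (\<C> L)"
  shows "is_lub (\<C> L) (ideal_span L A) A"
proof (rule least_UpperI)
  show "ideal_span L A \<sqsubseteq>\<^bsub>\<C> L\<^esub> J" if "J \<in> Upper (\<C> L) A" for J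
    using that assms ideal_span_least[of L J A] by (auto simp: Upper_def subset_iff)
  show "ideal_span L A \<in> carrier (\<C> L)"
    using assms round_ideal_span[of A] by auto
qed (use assms in \<open>simp_all add: ideal_span_upper\<close>)

lemma complete_lattice_C: "complete_lattice (\<C> L)"
proof -
  interpret C: partial_order "\<C> L" by (rule partial_order_C)
  show ?thesis
  proof (rule C.complete_latticeI)
    fix A assume A: "A \<subseteq> carrier (\<C> L)"
    show "\<exists>s. is_lub (\<C> L) s A"
      using is_lub_span[OF A] by blast
    \<comment> \<open>An infinite intersection of round ideals may fail to be round, so the infimum
      is the span of all lower bounds. Each member of \<open>A\<close> contains every lower bound
      and therefore their span.\<close>
    have "is_glb (\<C> L) (ideal_span L (Lower (\<C> L) A)) A"
    proof (rule greatest_LowerI)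
      show "ideal_span L (Lower (\<C> L) A) \<sqsubseteq>\<^bsub>\<C> L\<^esub> J" if "J \<in> A" for J
        using that A ideal_span_least[of L J "Lower (\<C> L) A"] by (auto simp: Lower_def subset_iff)
    qed (use A in \<open>auto simp: ideal_span_upper Lower_def intro!: round_ideal_span\<close>)
    then show "\<exists>i. is_glb (\<C> L) i A" by blast
  qed
qed

lemma C_Sup:
  assumes "\<And>I. I \<in> A \<Longrightarrow> round_ideal L I"
  shows "\<Squnion>\<^bsub>\<C> L\<^esub> A = ideal_span L A"
proof -
  interpret C: complete_lattice "\<C> L" by (rule complete_lattice_C)
  have A: "A \<subseteq> carrier (\<C> L)" using assms by auto
  show ?thesis
    using C.least_unique[OF C.sup_lub[OF A] is_lub_span[OF A]] .
qed

lemma C_meet: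
  assumes "round_ideal L I" "round_ideal L J"
  shows "I \<sqinter>\<^bsub>\<C> L\<^esub> J = I \<inter> J"
proof -
  interpret C: complete_lattice "\<C> L" by (rule complete_lattice_C)
  show ?thesis
    using assms C.meet_left[of I J] C.meet_right[of I J] C.meet_le[of "I \<inter> J" I J] round_ideal_Int
    by auto
qed

lemma C_top: "\<top>\<^bsub>\<C> L\<^esub> = carrier L"
proof -
  interpret C: complete_lattice "\<C> L" by (rule complete_lattice_C)
  show ?thesis
    using C.top_higher[of "carrier L"] C.top_closed round_ideal_carrier_set
    by (auto dest: round_ideal_carrier)
qed

lemma C_bottom: "\<bottom>\<^bsub>\<C> L\<^esub> = {\<bottom>}"
proof -
  interpret C: complete_lattice "\<C> L" by (rule complete_lattice_C)
  show ?thesis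
    using C.bottom_lower[of "{\<bottom>}"] C.bottom_closed round_ideal_bottom_set
    by (auto dest: round_ideal_bottom)
qed

lemma frame_C: "frame (\<C> L)"
proof -
  interpret C: complete_lattice "\<C> L" by (rule complete_lattice_C)
  show ?thesis
  proof
    fix I A assume I: "I \<in> carrier (\<C> L)" and A: "A \<subseteq> carrier (\<C> L)"
    let ?B = "(\<lambda>J. I \<inter> J) ` A"
    have RI: "round_ideal L I" and RA: "\<And>J. J \<in> A \<Longrightarrow> round_ideal L J"
      using I A by auto
    have span: "round_ideal L (ideal_span L A)" "round_ideal L (ideal_span L ?B)"
      using RI RA by (auto intro!: round_ideal_span round_ideal_Int)
    \<comment> \<open>The element \<open>i\<close> is fixed and the induction runs over
      \<open>x\<close>; the join case is binary distributivity in \<open>L\<close>. Taking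
      \<open>i = x\<close> afterwards, idempotence of meets gives the nontrivial inclusion of the
      frame law.\<close>
    have "i \<sqinter> x \<in> ideal_span L ?B" if "x \<in> ideal_span L A" "i \<in> I" for x i
      using that(1)
    proof induction
      have i: "i \<in> carrier L" using RI that(2) by (rule round_ideal_carrier)
      {
        case span_bottom
        then show ?case
          using i by (auto intro!: span_down[OF ideal_span.span_bottom] meet_right)
      next
        case (span_base J x)
        then have "i \<sqinter> x \<in> I \<inter> J"
          using RI RA that(2) by (intro meet_mem_Int)
        with span_base show ?case
          by (auto intro: ideal_span.span_base)
      next
        case (span_join x y)
        then show ?case
          using i span(1) by (simp add: join_meet_distrib ideal_span.span_join round_ideal_carrier)
      next
        case (span_down x y)
        then show ?case
          using i round_ideal_carrier[OF span(1)]
          by (intro ideal_span.span_down[OF span_down.IH])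
            (auto intro!: meet_le meet_left intro: le_trans[OF meet_right])
      }
    qed
    moreover have "x \<sqinter> x = x" if "x \<in> I" for x
      using round_ideal_carrier[OF RI that] by (simp add: meet_def)
    ultimately have "I \<inter> ideal_span L A \<subseteq> ideal_span L ?B"
      by (metis IntE subsetI)
    moreover have "ideal_span L ?B \<subseteq> I \<inter> ideal_span L A"
      by (rule ideal_span_least) (use RI span in \<open>auto intro: round_ideal_Int ideal_span.span_base\<close>)
    moreover have "(\<lambda>J. I \<sqinter>\<^bsub>\<C> L\<^esub> J) ` A = ?B"
      using RI RA by (simp add: C_meet)
    moreover have "\<Squnion>\<^bsub>\<C> L\<^esub> ?B = ideal_span L ?B" "\<Squnion>\<^bsub>\<C> L\<^esub> A = ideal_span L A"
      by (rule C_Sup; use RI RA round_ideal_Int in blast)+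
    ultimately show "I \<sqinter>\<^bsub>\<C> L\<^esub> \<Squnion>\<^bsub>\<C> L\<^esub> A = \<Squnion>\<^bsub>\<C> L\<^esub> ((\<lambda>J. I \<sqinter>\<^bsub>\<C> L\<^esub> J) ` A)"
      using RI span(1) by (simp add: C_meet subset_antisym)
  qed
qed

section \<open>Suprema of round ideals, the way-below relation and the proximity of
  \<open>\<C> L\<close>\<close>

text \<open>Both sides have the same upper bounds: the generating rules never leave the downset of
  an element that bounds all members of \<open>A\<close>. This is preservation of joins by the
  counit.\<close>

lemma Sup_span:
  assumes "\<And>I. I \<in> A \<Longrightarrow> round_ideal L I"
  shows "\<Squnion>(ideal_span L A) = \<Squnion>((\<lambda>I. \<Squnion>I) ` A)"
proof (rule Sup_eqI)
  have sub: "I \<subseteq> carrier L" if "I \<in> A" for I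
    using assms round_ideal_subset that by blast
  then have im: "(\<lambda>I. \<Squnion>I) ` A \<subseteq> carrier L" by auto
  then show "\<Squnion>((\<lambda>I. \<Squnion>I) ` A) \<in> carrier L" by simp
  show span: "ideal_span L A \<subseteq> carrier L"
    using assms round_ideal_span round_ideal_subset by blast
  show "x \<sqsubseteq> \<Squnion>((\<lambda>I. \<Squnion>I) ` A)" if "x \<in> ideal_span L A" for x
    using that
  proof induction
    case (span_base I x)
    then have "x \<sqsubseteq> \<Squnion>I" "\<Squnion>I \<sqsubseteq> \<Squnion>((\<lambda>I. \<Squnion>I) ` A)"
      using sub im by (auto intro!: sup_upper)
    then show ?case
      using span_base sub im by (meson le_trans subsetD sup_closed)
  next
    case (span_join x y)
    then show ?case using span im by (auto intro!: join_le)
  next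
    case (span_down x y)
    then show ?case using span im by (meson le_trans subsetD sup_closed)
  qed (use im in auto)
  show "\<Squnion>((\<lambda>I. \<Squnion>I) ` A) \<sqsubseteq> u"
    if "u \<in> carrier L" "\<And>x. x \<in> ideal_span L A \<Longrightarrow> x \<sqsubseteq> u" for u
    using that sub im by (auto intro!: sup_least intro: span_base)
qed

text \<open>Two applications of the frame law reduce the inequality from right to left to the meets
  \<open>x \<sqinter> y\<close> with \<open>x \<in> I\<close> and \<open>y \<in> J\<close>, and
  these already lie in \<open>I \<inter> J\<close>.\<close>

lemma Sup_Int:
  assumes I: "round_ideal L I" and J: "round_ideal L J"
  shows "\<Squnion>(I \<inter> J) = \<Squnion>I \<sqinter> \<Squnion>J"
proof (rule le_antisym)
  note sub = round_ideal_subset[OF I] round_ideal_subset[OF J]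
  have IJ: "I \<inter> J \<subseteq> carrier L" using sub by auto
  have S: "\<Squnion>(I \<inter> J) \<in> carrier L" "\<Squnion>I \<in> carrier L" "\<Squnion>J \<in> carrier L"
    using sub IJ by simp_all
  then show "\<Squnion>(I \<inter> J) \<in> carrier L" "\<Squnion>I \<sqinter> \<Squnion>J \<in> carrier L" by simp_all
  show "\<Squnion>(I \<inter> J) \<sqsubseteq> \<Squnion>I \<sqinter> \<Squnion>J"
    using S sub IJ by (auto intro!: meet_le sup_least sup_upper)
  have "x \<sqinter> y \<sqsubseteq> \<Squnion>(I \<inter> J)" if "x \<in> I" "y \<in> J" for x y
    using IJ meet_mem_Int[OF I J that] by (rule sup_upper)
  then have "x \<sqinter> \<Squnion>J \<sqsubseteq> \<Squnion>(I \<inter> J)" if "x \<in> I" for x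
    using that sub S by (subst meet_Sup_distrib) (auto intro!: sup_least meet_closed)
  then have "\<Squnion>J \<sqinter> \<Squnion>I \<sqsubseteq> \<Squnion>(I \<inter> J)"
    using sub S by (subst meet_Sup_distrib) (auto intro!: sup_least meet_closed simp: meet_comm[of _ "\<Squnion>J"])
  then show "\<Squnion>I \<sqinter> \<Squnion>J \<sqsubseteq> \<Squnion>(I \<inter> J)" by (simp add: meet_comm)
qed

lemma Sup_mono:
  assumes "I \<subseteq> J" "J \<subseteq> carrier L"
  shows "\<Squnion>I \<sqsubseteq> \<Squnion>J"
  using assms by (auto intro!: sup_least intro: sup_upper)

lemma Sup_round_carrier: "round_ideal L I \<Longrightarrow> \<Squnion>I \<in> carrier L"
  by (simp add: round_ideal_subset)

lemma mem_le_Sup: "\<lbrakk>round_ideal L I; x \<in> I\<rbrakk> \<Longrightarrow> x \<sqsubseteq> \<Squnion>I"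
  by (simp add: round_ideal_subset sup_upper)

lemma mem_prox_Sup: "\<lbrakk>round_ideal L I; x \<in> I\<rbrakk> \<Longrightarrow> x \<prec> \<Squnion>I"
  by (meson Sup_round_carrier mem_le_Sup prox_le_trans round_ideal_round)

text \<open>Two elements of a directed union lie in a common member, so the union is already closed
  under the generating rules; nonemptiness of \<open>D\<close> supplies bottom.\<close>

lemma C_Sup_directed:
  assumes "directed_subset (\<RR> L) D"
  shows "\<Squnion>\<^bsub>\<C> L\<^esub> D = \<Union>D"
proof -
  have D: "\<And>I. I \<in> D \<Longrightarrow> round_ideal L I" "D \<noteq> {}"
    and dir: "\<And>I J. \<lbrakk>I \<in> D; J \<in> D\<rbrakk> \<Longrightarrow> \<exists>K\<in>D. I \<subseteq> K \<and> J \<subseteq> K"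
    using assms by (auto simp: directed_subset_def R_carrier R_le)
  have "x \<in> \<Union>D" if "x \<in> ideal_span L D" for x
    using that
  proof induction
    case span_bottom
    then show ?case using D(2) round_ideal_bottom[OF D(1)] by blast
  next
    case (span_join x y)
    then obtain I J where "I \<in> D" "J \<in> D" "x \<in> I" "y \<in> J" by auto
    then obtain K where "K \<in> D" "x \<in> K" "y \<in> K" using dir by blast
    then show ?case using round_ideal_join[OF D(1)] by blast
  next
    case (span_down x y)
    then show ?case using round_ideal_down[OF D(1)] by blast
  qed auto
  then show ?thesis
    using D(1) by (auto simp: C_Sup intro: span_base)
qed

lemma way_below_kappa_iff:
  assumes I: "round_ideal L I" and a: "a \<in> carrier L"
  shows "way_below (\<RR> L) I (\<kappa> L a) \<longleftrightarrow> \<Squnion>I \<prec> a"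
proof
  assume w: "way_below (\<RR> L) I (\<kappa> L a)"
  \<comment> \<open>The test family consists of the \<open>\<kappa> L c\<close> with
    \<open>c \<prec> a\<close>. Joins of two such \<open>c\<close> make it directed, and by
    interpolation its union contains \<open>\<kappa> L a\<close>. Way-below then yields one
    \<open>c\<close> with \<open>I \<subseteq> \<kappa> L c\<close>, so
    \<open>\<Squnion>I \<sqsubseteq> c\<close> and \<open>c \<prec> a\<close>.\<close>
  let ?D = "\<kappa> L ` \<kappa> L a"
  have "directed_subset (\<RR> L) ?D"
    unfolding directed_subset_def R_carrier R_le
  proof (intro conjI ballI)
    show "?D \<subseteq> {I. round_ideal L I}"
      using a by (auto simp: kappa_eq[of a] dest!: prox_carrier intro!: round_ideal_kappa)
    show "?D \<noteq> {}"
      using round_ideal_bottom[OF round_ideal_kappa[OF a]] by blast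
    fix X Y assume "X \<in> ?D" "Y \<in> ?D"
    then obtain x y where xy: "x \<prec> a" "y \<prec> a" "X = \<kappa> L x" "Y = \<kappa> L y"
      using a by (auto simp: kappa_eq)
    then have "x \<in> carrier L" "y \<in> carrier L" using prox_carrier by blast+
    then have "X \<subseteq> \<kappa> L (x \<squnion> y)" "Y \<subseteq> \<kappa> L (x \<squnion> y)"
      using xy join_left join_right prox_le_trans by (auto simp: kappa_eq)
    moreover have "\<kappa> L (x \<squnion> y) \<in> ?D"
      using xy a prox_join_same by (auto simp: kappa_eq)
    ultimately show "\<exists>Z\<in>?D. X \<subseteq> Z \<and> Y \<subseteq> Z" by blast
  qed
  moreover have "\<kappa> L a \<subseteq> \<Union>?D"
  proof
    fix x assume "x \<in> \<kappa> L a"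
    then obtain c where "x \<prec> c" "c \<prec> a"
      using a prox_interpolate by (auto simp: kappa_eq)
    then have "x \<in> \<kappa> L c" "c \<in> \<kappa> L a"
      using a prox_carrier[of x c] by (auto simp: kappa_eq)
    then show "x \<in> \<Union>?D" by blast
  qed
  ultimately have "\<exists>d\<in>?D. I \<subseteq> d"
    using w C_Sup_directed[of ?D] unfolding way_below_def R_le R_sup by metis
  then obtain c where c: "c \<prec> a" "I \<subseteq> \<kappa> L c"
    using a by (auto simp: kappa_eq[of a])
  then have "c \<in> carrier L" using prox_carrier by blast
  then have "\<Squnion>I \<sqsubseteq> c"
    using c Sup_mono[of I "\<kappa> L c"] Sup_kappa round_ideal_subset[OF round_ideal_kappa] by simp
  then show "\<Squnion>I \<prec> a"
    using c(1) Sup_round_carrier[OF I] le_prox_trans by blast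
next
  assume p: "\<Squnion>I \<prec> a"
  show "way_below (\<RR> L) I (\<kappa> L a)"
    unfolding way_below_def
  proof (intro conjI allI impI)
    fix D assume D: "directed_subset (\<RR> L) D \<and> \<kappa> L a \<sqsubseteq>\<^bsub>\<RR> L\<^esub> \<Squnion>\<^bsub>\<RR> L\<^esub> D"
    \<comment> \<open>The union of \<open>D\<close> contains \<open>\<kappa> L a\<close>, of which
      \<open>\<Squnion>I\<close> is an element. A member of \<open>D\<close> that contains
      \<open>\<Squnion>I\<close> is a downset and so contains all of \<open>I\<close>.\<close>
    then have "\<Squnion>I \<in> \<Union>D"
      using p a by (auto simp: R_le R_sup C_Sup_directed kappa_eq)
    then obtain J where J: "J \<in> D" "\<Squnion>I \<in> J" by blast
    moreover have "round_ideal L J" using J D by (auto simp: directed_subset_def R_carrier)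
    ultimately have "I \<subseteq> J"
      by (auto intro: round_ideal_down[of L J "\<Squnion>I"] mem_le_Sup[OF I] round_ideal_carrier[OF I])
    then show "\<exists>d\<in>D. I \<sqsubseteq>\<^bsub>\<RR> L\<^esub> d"
      using J(1) by (auto simp: R_le)
  qed (use I a round_ideal_kappa in \<open>auto simp: R_carrier\<close>)
qed

text \<open>The working form of the proximity, from which way-below has been eliminated by
  \<open>way_below_kappa_iff\<close> at \<open>a = \<Squnion>J\<close>.\<close>

lemma C_prox:
  "I \<prec>\<^bsub>\<C> L\<^esub> J \<longleftrightarrow> round_ideal L I \<and> round_ideal L J \<and> I \<subseteq> J \<and> \<Squnion>I \<prec> \<Squnion>J"
  using way_below_kappa_iff[of I "\<Squnion>J"] Sup_round_carrier[of J] by (auto simp: C_obj_def R_carrier)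

lemma kappa_subset: "\<lbrakk>round_ideal L I; a \<in> I\<rbrakk> \<Longrightarrow> \<kappa> L a \<subseteq> I"
  using round_ideal_carrier[of L I a] round_ideal_down[of L I a]
  by (auto simp: kappa_def dest: prox_le)

text \<open>Together with \<open>kappa_subset\<close> this presents a round ideal \<open>I\<close>
  as the union of the ideals \<open>\<kappa> L a\<close> with \<open>a \<in> I\<close>.\<close>

lemma mem_kappa_mem:
  assumes "round_ideal L I" "x \<in> I"
  shows "\<exists>a\<in>I. x \<in> \<kappa> L a"
proof -
  obtain a where "a \<in> I" "x \<prec> a" using round_ideal_round[OF assms] by blast
  then show ?thesis
    using prox_carrier[of x a] by (intro bexI[of _ a]) (simp_all add: kappa_eq)
qed

lemma C_Sup_Sup:
  assumes "\<And>I. I \<in> A \<Longrightarrow> round_ideal L I"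
  shows "\<Squnion>(\<Squnion>\<^bsub>\<C> L\<^esub> A) = \<Squnion>((\<lambda>I. \<Squnion>I) ` A)"
  using assms by (simp add: C_Sup Sup_span)

lemma C_Sup_join:
  assumes "round_ideal L I" "round_ideal L J"
  shows "\<Squnion>(I \<squnion>\<^bsub>\<C> L\<^esub> J) = \<Squnion>I \<squnion> \<Squnion>J"
  using assms C_Sup_Sup[of "{I, J}"] by (auto simp: join_def)

section \<open>The proximity axioms for \<open>\<C> L\<close>\<close>

lemma proximity_frame_C: "proximity_frame (\<C> L)"
proof -
  interpret C: frame "\<C> L" by (rule frame_C)
  show ?thesis
  proof
    show "I \<in> carrier (\<C> L) \<and> J \<in> carrier (\<C> L)" "I \<sqsubseteq>\<^bsub>\<C> L\<^esub> J" if "I \<prec>\<^bsub>\<C> L\<^esub> J" for I J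
      using that by (auto simp: C_prox)
    show "\<bottom>\<^bsub>\<C> L\<^esub> \<prec>\<^bsub>\<C> L\<^esub> \<bottom>\<^bsub>\<C> L\<^esub>"
      by (simp add: C_prox C_bottom round_ideal_bottom_set prox_bottom)
    have "\<Squnion>(carrier L) = \<top>"
      by (rule Sup_eqI) auto
    then show "\<top>\<^bsub>\<C> L\<^esub> \<prec>\<^bsub>\<C> L\<^esub> \<top>\<^bsub>\<C> L\<^esub>"
      by (simp add: C_prox C_top round_ideal_carrier_set prox_top)
    show "I1 \<sqinter>\<^bsub>\<C> L\<^esub> I2 \<prec>\<^bsub>\<C> L\<^esub> J1 \<sqinter>\<^bsub>\<C> L\<^esub> J2" if "I1 \<prec>\<^bsub>\<C> L\<^esub> J1" "I2 \<prec>\<^bsub>\<C> L\<^esub> J2" for I1 J1 I2 J2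
      using that by (auto simp: C_prox C_meet Sup_Int round_ideal_Int intro!: prox_meet)
    show "I1 \<squnion>\<^bsub>\<C> L\<^esub> I2 \<prec>\<^bsub>\<C> L\<^esub> J1 \<squnion>\<^bsub>\<C> L\<^esub> J2" if p: "I1 \<prec>\<^bsub>\<C> L\<^esub> J1" "I2 \<prec>\<^bsub>\<C> L\<^esub> J2" for I1 J1 I2 J2
    proof -
      have r: "round_ideal L I1" "round_ideal L I2" "round_ideal L J1" "round_ideal L J2"
        "I1 \<subseteq> J1" "I2 \<subseteq> J2"
        using p by (auto simp: C_prox)
      then have "round_ideal L (I1 \<squnion>\<^bsub>\<C> L\<^esub> I2)" "round_ideal L (J1 \<squnion>\<^bsub>\<C> L\<^esub> J2)"
        using C.join_closed by auto
      moreover have "I1 \<squnion>\<^bsub>\<C> L\<^esub> I2 \<subseteq> J1 \<squnion>\<^bsub>\<C> L\<^esub> J2"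
        using r calculation C.join_le[of I1 "J1 \<squnion>\<^bsub>\<C> L\<^esub> J2" I2] C.join_left[of J1 J2] C.join_right[of J1 J2]
        by auto
      ultimately show ?thesis
        using p r by (simp add: C_prox C_Sup_join prox_join)
    qed
    show "I \<prec>\<^bsub>\<C> L\<^esub> J" if "I \<in> carrier (\<C> L)" "J \<in> carrier (\<C> L)" "I \<sqsubseteq>\<^bsub>\<C> L\<^esub> I'" "I' \<prec>\<^bsub>\<C> L\<^esub> J'" "J' \<sqsubseteq>\<^bsub>\<C> L\<^esub> J"
      for I I' J J'
      using that prox_mono[OF _ _ Sup_mono[of I I'] _ Sup_mono[of J' J]]
      by (auto simp: C_prox round_ideal_subset)
    show "\<exists>K. I \<prec>\<^bsub>\<C> L\<^esub> K \<and> K \<prec>\<^bsub>\<C> L\<^esub> J" if "I \<prec>\<^bsub>\<C> L\<^esub> J" for I J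
    proof -
      have r: "round_ideal L I" "round_ideal L J" "I \<subseteq> J" and "\<Squnion>I \<prec> \<Squnion>J"
        using that by (auto simp: C_prox)
      then obtain c where c: "\<Squnion>I \<prec> c" "c \<prec> \<Squnion>J" using prox_interpolate by blast
      then have cc: "c \<in> carrier L" using prox_carrier by blast
      \<comment> \<open>From \<open>c \<prec> \<Squnion>J\<close> it does not follow that
        \<open>c \<in> J\<close>, so \<open>\<kappa> L c\<close> is cut down to \<open>J\<close>. As
        \<open>c \<sqsubseteq> \<Squnion>J\<close>, the supremum is still \<open>c\<close>.\<close>
      have K: "round_ideal L (J \<inter> \<kappa> L c)"
        using r cc by (simp add: round_ideal_Int round_ideal_kappa)
      have "\<Squnion>J \<sqinter> c = c"
        using c cc Sup_round_carrier[OF r(2)] prox_le le_refl meet_le meet_right le_antisym meet_closed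
        by metis
      then have "\<Squnion>(J \<inter> \<kappa> L c) = c"
        using r cc by (simp add: Sup_Int Sup_kappa round_ideal_kappa)
      moreover have "I \<subseteq> \<kappa> L c"
        using c cc r by (auto simp: kappa_eq intro: le_prox_trans mem_le_Sup round_ideal_carrier)
      ultimately show ?thesis
        using r K c by (intro exI[of _ "J \<inter> \<kappa> L c"]) (auto simp: C_prox)
    qed
    show "J = \<Squnion>\<^bsub>\<C> L\<^esub> {I. I \<prec>\<^bsub>\<C> L\<^esub> J}" if "J \<in> carrier (\<C> L)" for J
    proof (rule C.Sup_eqI[symmetric])
      fix U assume U: "\<And>I. I \<in> {I. I \<prec>\<^bsub>\<C> L\<^esub> J} \<Longrightarrow> I \<sqsubseteq>\<^bsub>\<C> L\<^esub> U"
      have J: "round_ideal L J" using that by simp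
      \<comment> \<open>The ideals \<open>\<kappa> L b\<close> with \<open>b \<in> J\<close> are
        proximal to \<open>J\<close>, because \<open>\<Squnion>(\<kappa> L b) = b\<close> and
        \<open>b \<prec> \<Squnion>J\<close>; they cover \<open>J\<close>.\<close>
      have "\<kappa> L b \<subseteq> U" if "b \<in> J" for b
        using that U[of "\<kappa> L b"] J round_ideal_carrier[OF J that]
        by (simp add: C_prox round_ideal_kappa kappa_subset Sup_kappa mem_prox_Sup)
      then show "J \<sqsubseteq>\<^bsub>\<C> L\<^esub> U"
        using mem_kappa_mem[OF J] by (simp add: subset_iff) blast
    qed (use that in \<open>auto simp: C_prox\<close>)
  qed
qed

end

section \<open>Equality of morphisms out of \<open>\<C> L\<close>\<close>

lemma pf_homI:
  assumes "f \<in> carrier L \<rightarrow>\<^sub>E carrier M" "f \<top>\<^bsub>L\<^esub> = \<top>\<^bsub>M\<^esub>"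
    "\<And>a b. \<lbrakk>a \<in> carrier L; b \<in> carrier L\<rbrakk> \<Longrightarrow> f (a \<sqinter>\<^bsub>L\<^esub> b) = f a \<sqinter>\<^bsub>M\<^esub> f b"
    "\<And>A. A \<subseteq> carrier L \<Longrightarrow> f (\<Squnion>\<^bsub>L\<^esub> A) = \<Squnion>\<^bsub>M\<^esub> (f ` A)"
    "\<And>a b. a \<prec>\<^bsub>L\<^esub> b \<Longrightarrow> f a \<prec>\<^bsub>M\<^esub> f b"
  shows "f \<in> pf_hom L M"
  using assms by (simp add: pf_hom_def)

lemma comult_extensional: "comult L \<in> extensional {I. round_ideal L I}"
  and C_map_extensional: "C_map L M f \<in> extensional {I. round_ideal L I}"
  and counit_extensional: "counit L \<in> extensional {I. round_ideal L I}"
  by (simp_all add: comult_def C_map_def round_map_def counit_def R_carrier)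

lemma counit_eq: "round_ideal L I \<Longrightarrow> counit L I = \<Squnion>\<^bsub>L\<^esub> I"
  by (simp add: counit_def)

lemma pf_comp_C: "round_ideal L I \<Longrightarrow> pf_comp (\<C> L) g f I = g (f I)"
  by (simp add: pf_comp_def compose_def)

lemma pf_id_C: "round_ideal L I \<Longrightarrow> pf_id (\<C> L) I = I"
  by (simp add: pf_id_def)

text \<open>A composite is \<open>undefined\<close> off its domain, so comparison on round ideals
  suffices. The naturality and comonad equations are all reduced to round ideals in this
  way.\<close>

lemma pf_comp_C_eqI:
  assumes "\<And>I. round_ideal L I \<Longrightarrow> g (f I) = h I" "h \<in> extensional {I. round_ideal L I}"
  shows "pf_comp (\<C> L) g f = h"
  using assms by (auto simp: pf_comp_def compose_def extensional_def fun_eq_iff)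

lemma pf_comp_C_extensional: "pf_comp (\<C> L) g f \<in> extensional {I. round_ideal L I}"
  and pf_id_C_extensional: "pf_id (\<C> L) \<in> extensional {I. round_ideal L I}"
  by (simp_all add: pf_comp_def compose_def pf_id_def)

section \<open>The counit and the comultiplication as morphisms\<close>

context proximity_frame
begin

text \<open>Joins are handled by \<open>Sup_span\<close>, meets by \<open>Sup_Int\<close>, and
  preservation of the proximity is the last conjunct of \<open>C_prox\<close>.\<close>

lemma counit_hom: "counit L \<in> pf_hom (\<C> L) L"
proof (rule pf_homI)
  show "counit L \<in> carrier (\<C> L) \<rightarrow>\<^sub>E carrier L"
    using counit_extensional[of L] by (auto simp: PiE_iff counit_eq Sup_round_carrier)
  have "\<Squnion>(carrier L) = \<top>"
    by (rule Sup_eqI) auto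
  then show "counit L \<top>\<^bsub>\<C> L\<^esub> = \<top>"
    by (simp add: C_top counit_eq round_ideal_carrier_set)
  show "counit L (\<Squnion>\<^bsub>\<C> L\<^esub> A) = \<Squnion>(counit L ` A)" if "A \<subseteq> carrier (\<C> L)" for A
  proof -
    have A: "\<And>I. I \<in> A \<Longrightarrow> round_ideal L I" using that by auto
    then have "counit L ` A = (\<lambda>I. \<Squnion>I) ` A" by (simp add: counit_eq)
    then show ?thesis
      using Sup_span[OF A] C_Sup[OF A] round_ideal_span[OF A] by (simp add: counit_eq)
  qed
qed (auto simp: counit_eq C_meet C_prox Sup_Int round_ideal_Int)

text \<open>Roundness gives \<open>a \<in> I\<close> with \<open>\<Squnion>K \<prec> a\<close>,
  whence \<open>K \<subseteq> \<kappa> L a\<close>; the converse rests on \<open>Sup_kappa\<close>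
  and downward closure. The right-hand side is the defining condition of the
  comultiplication.\<close>

lemma Sup_mem_iff:
  assumes "round_ideal L I" "round_ideal L K"
  shows "\<Squnion>K \<in> I \<longleftrightarrow> (\<exists>a\<in>I. K \<prec>\<^bsub>\<C> L\<^esub> \<kappa> L a)"
proof
  assume "\<Squnion>K \<in> I"
  then obtain a where a: "a \<in> I" "\<Squnion>K \<prec> a" using round_ideal_round[OF assms(1)] by blast
  then have "a \<in> carrier L" using prox_carrier by blast
  moreover have "K \<subseteq> \<kappa> L a"
    using a(2) calculation assms(2)
    by (auto simp: kappa_eq intro: le_prox_trans[OF mem_le_Sup[OF assms(2)]] round_ideal_carrier[OF assms(2)])
  ultimately show "\<exists>a\<in>I. K \<prec>\<^bsub>\<C> L\<^esub> \<kappa> L a"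
    using a assms(2) by (intro bexI[of _ a]) (simp_all add: C_prox round_ideal_kappa Sup_kappa)
next
  assume "\<exists>a\<in>I. K \<prec>\<^bsub>\<C> L\<^esub> \<kappa> L a"
  then obtain a where a: "a \<in> I" "K \<prec>\<^bsub>\<C> L\<^esub> \<kappa> L a" by blast
  then have "\<Squnion>K \<prec> a"
    using round_ideal_carrier[OF assms(1) a(1)] by (simp add: C_prox Sup_kappa)
  then show "\<Squnion>K \<in> I"
    using round_ideal_down[OF assms(1) a(1)] prox_le Sup_round_carrier[OF assms(2)] by blast
qed

lemma comult_eq:
  assumes "round_ideal L I"
  shows "comult L I = {K. round_ideal L K \<and> \<Squnion>K \<in> I}"
  using assms Sup_mem_iff[OF assms] by (auto simp: comult_def round_map_def R_carrier)

lemma kappa_mem_comult: "\<lbrakk>round_ideal L I; a \<in> I\<rbrakk> \<Longrightarrow> \<kappa> L a \<in> comult L I"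
  by (simp add: comult_eq round_ideal_kappa Sup_kappa round_ideal_carrier)

lemma round_ideal_comult:
  assumes I: "round_ideal L I"
  shows "round_ideal (\<C> L) (comult L I)"
proof -
  interpret C: proximity_frame "\<C> L" by (rule proximity_frame_C)
  show ?thesis
  proof (rule round_idealI)
    show "\<bottom>\<^bsub>\<C> L\<^esub> \<in> comult L I"
      using I by (simp add: C_bottom comult_eq round_ideal_bottom_set round_ideal_bottom)
    show "J \<squnion>\<^bsub>\<C> L\<^esub> K \<in> comult L I" if "J \<in> comult L I" "K \<in> comult L I" for J K
      using that C.join_closed[of J K] I by (simp add: comult_eq C_Sup_join round_ideal_join)
    show "K \<in> comult L I" if "J \<in> comult L I" "K \<in> carrier (\<C> L)" "K \<sqsubseteq>\<^bsub>\<C> L\<^esub> J" for J K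
      using that I round_ideal_down[OF I, of "\<Squnion>J" "\<Squnion>K"] Sup_mono[of K J]
      by (simp add: comult_eq Sup_round_carrier round_ideal_subset)
    \<comment> \<open>The witness is \<open>\<kappa> L a\<close> with \<open>a \<in> I\<close> from
      \<open>Sup_mem_iff\<close>, which belongs to \<open>comult L I\<close> because its supremum is
      \<open>a\<close>.\<close>
    show "\<exists>J\<in>comult L I. K \<prec>\<^bsub>\<C> L\<^esub> J" if "K \<in> comult L I" for K
      using that I Sup_mem_iff[OF I] kappa_mem_comult[OF I] by (auto simp: comult_eq[OF I])
  qed (use I in \<open>simp add: comult_eq\<close>)
qed

text \<open>The members of \<open>comult L I\<close> lie inside \<open>I\<close>, and among them are
  the \<open>\<kappa> L a\<close> with \<open>a \<in> I\<close>, which cover \<open>I\<close>.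
  Besides being a counit law, this computes the suprema that enter the proximity of
  \<open>\<C> (\<C> L)\<close>.\<close>

lemma C_Sup_comult:
  assumes I: "round_ideal L I"
  shows "\<Squnion>\<^bsub>\<C> L\<^esub> (comult L I) = I"
proof -
  interpret C: proximity_frame "\<C> L" by (rule proximity_frame_C)
  show ?thesis
  proof (rule C.Sup_eqI)
    fix U assume "\<And>K. K \<in> comult L I \<Longrightarrow> K \<sqsubseteq>\<^bsub>\<C> L\<^esub> U"
    then have "\<kappa> L a \<subseteq> U" if "a \<in> I" for a
      using kappa_mem_comult[OF I that] by simp
    then show "I \<sqsubseteq>\<^bsub>\<C> L\<^esub> U"
      using mem_kappa_mem[OF I] by (simp add: subset_iff) blast
  next
    fix K assume "K \<in> comult L I"
    then have K: "round_ideal L K" "\<Squnion>K \<in> I" using I by (simp_all add: comult_eq)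
    then show "K \<sqsubseteq>\<^bsub>\<C> L\<^esub> I"
      using round_ideal_down[OF I K(2)] by (auto intro: round_ideal_carrier[OF K(1)] mem_le_Sup[OF K(1)])
  qed (use I in \<open>auto simp: comult_eq\<close>)
qed

text \<open>Preservation of joins by the comultiplication. The inclusion from right to left is
  monotonicity; the other one has to place an ideal \<open>K\<close> with \<open>\<Squnion>K\<close>
  in the span of \<open>A\<close> below some generated ideal.\<close>

lemma comult_span:
  assumes A: "\<And>I. I \<in> A \<Longrightarrow> round_ideal L I"
  shows "comult L (ideal_span L A) = ideal_span (\<C> L) (comult L ` A)"
proof
  interpret C: proximity_frame "\<C> L" by (rule proximity_frame_C)
  have S: "round_ideal L (ideal_span L A)" using A by (rule round_ideal_span)
  have S': "round_ideal (\<C> L) (ideal_span (\<C> L) (comult L ` A))"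
    using A by (auto intro!: C.round_ideal_span round_ideal_comult)
  show "ideal_span (\<C> L) (comult L ` A) \<subseteq> comult L (ideal_span L A)"
  proof (rule ideal_span_least[OF round_ideal_comult[OF S]])
    fix X assume "X \<in> comult L ` A"
    then obtain I where "I \<in> A" "X = comult L I" by blast
    then show "X \<subseteq> comult L (ideal_span L A)"
      using ideal_span_upper[of I A L] by (auto simp: comult_eq S A)
  qed
  \<comment> \<open>Each rule for elements is matched by one for ideals: bottom lies in the least
    round ideal, an element of a member \<open>I\<close> in some \<open>\<kappa> L a\<close> with
    \<open>a \<in> I\<close>, and a join of elements in the join of their ideals.\<close>
  have ex: "\<exists>K\<in>ideal_span (\<C> L) (comult L ` A). x \<in> K" if "x \<in> ideal_span L A" for x
    using that
  proof induction
    case span_bottom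
    show ?case
      using round_ideal_bottom[OF S'] by (auto simp: C_bottom)
  next
    case (span_base I x)
    then obtain a where "a \<in> I" "x \<in> \<kappa> L a" using mem_kappa_mem[OF A] by blast
    moreover have "\<kappa> L a \<in> ideal_span (\<C> L) (comult L ` A)"
      using span_base kappa_mem_comult[OF A] calculation by (blast intro: ideal_span.span_base)
    ultimately show ?case by blast
  next
    case (span_join x y)
    then obtain J K where JK: "J \<in> ideal_span (\<C> L) (comult L ` A)" "x \<in> J"
      "K \<in> ideal_span (\<C> L) (comult L ` A)" "y \<in> K" by blast
    then have R: "round_ideal L J" "round_ideal L K" "round_ideal L (J \<squnion>\<^bsub>\<C> L\<^esub> K)"
      using round_ideal_carrier[OF S'] C.join_closed[of J K] by auto
    then have "x \<squnion> y \<in> J \<squnion>\<^bsub>\<C> L\<^esub> K"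
      using JK C.join_left[of J K] C.join_right[of J K] by (auto intro!: round_ideal_join)
    then show ?case
      using JK by (blast intro: ideal_span.span_join)
  next
    case (span_down x y)
    then obtain K where K: "K \<in> ideal_span (\<C> L) (comult L ` A)" "x \<in> K" by blast
    then have "round_ideal L K" using round_ideal_carrier[OF S'] by simp
    then have "y \<in> K" using K(2) span_down.hyps(2,3) by (rule round_ideal_down)
    then show ?case using K(1) by blast
  qed
  show "comult L (ideal_span L A) \<subseteq> ideal_span (\<C> L) (comult L ` A)"
  proof
    fix K assume "K \<in> comult L (ideal_span L A)"
    then have K: "round_ideal L K" "\<Squnion>K \<in> ideal_span L A" by (simp_all add: comult_eq S)
    \<comment> \<open>With \<open>x = \<Squnion>K\<close> the ideal \<open>J\<close> contains
      \<open>\<Squnion>K\<close>, hence all of \<open>K\<close>, and downward closure of the span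
      finishes.\<close>
    then obtain J where J: "J \<in> ideal_span (\<C> L) (comult L ` A)" "\<Squnion>K \<in> J" using ex by blast
    then have "round_ideal L J" using round_ideal_carrier[OF S'] by simp
    then have "K \<subseteq> J"
      using round_ideal_down[of L J "\<Squnion>K"] J(2)
      by (auto intro: mem_le_Sup[OF K(1)] round_ideal_carrier[OF K(1)])
    then show "K \<in> ideal_span (\<C> L) (comult L ` A)"
      using round_ideal_down[OF S' J(1)] K(1) by simp
  qed
qed

lemma comult_hom: "comult L \<in> pf_hom (\<C> L) (\<C> (\<C> L))"
proof (rule pf_homI)
  interpret C: proximity_frame "\<C> L" by (rule proximity_frame_C)
  show "comult L \<in> carrier (\<C> L) \<rightarrow>\<^sub>E carrier (\<C> (\<C> L))"
    using comult_extensional[of L] by (auto simp: PiE_iff round_ideal_comult)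
  show "comult L \<top>\<^bsub>\<C> L\<^esub> = \<top>\<^bsub>\<C> (\<C> L)\<^esub>"
    by (auto simp: C_top C.C_top comult_eq round_ideal_carrier_set Sup_round_carrier)
  show "comult L (I \<sqinter>\<^bsub>\<C> L\<^esub> J) = comult L I \<sqinter>\<^bsub>\<C> (\<C> L)\<^esub> comult L J"
    if "I \<in> carrier (\<C> L)" "J \<in> carrier (\<C> L)" for I J
    using that C.C_meet[OF round_ideal_comult round_ideal_comult, of I J]
    by (auto simp: C_meet comult_eq round_ideal_Int)
  show "comult L (\<Squnion>\<^bsub>\<C> L\<^esub> A) = \<Squnion>\<^bsub>\<C> (\<C> L)\<^esub> (comult L ` A)" if "A \<subseteq> carrier (\<C> L)" for A
  proof -
    have A: "\<And>I. I \<in> A \<Longrightarrow> round_ideal L I" using that by auto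
    then have "\<And>X. X \<in> comult L ` A \<Longrightarrow> round_ideal (\<C> L) X" using round_ideal_comult by blast
    from C.C_Sup[OF this] show ?thesis
      using C_Sup[OF A] comult_span[OF A] by simp
  qed
  show "comult L I \<prec>\<^bsub>\<C> (\<C> L)\<^esub> comult L J" if "I \<prec>\<^bsub>\<C> L\<^esub> J" for I J
  proof -
    have "round_ideal L I" "round_ideal L J" "I \<subseteq> J" using that by (auto simp: C_prox)
    moreover from this have "comult L I \<subseteq> comult L J" by (auto simp: comult_eq)
    \<comment> \<open>By \<open>C_Sup_comult\<close> the two suprema are \<open>I\<close> and
      \<open>J\<close> again, so the condition on suprema is the hypothesis itself.\<close>
    ultimately show ?thesis
      using that by (simp add: C.C_prox round_ideal_comult C_Sup_comult)
  qed
qed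

end

section \<open>The action on morphisms and naturality\<close>

locale pf_morphism = L: proximity_frame L + M: proximity_frame M
  for L :: "'a prox_frame" and M :: "'b prox_frame" +
  fixes f
  assumes hom: "f \<in> pf_hom L M"
begin

lemma closed: "x \<in> carrier L \<Longrightarrow> f x \<in> carrier M"
  and hom_top: "f \<top>\<^bsub>L\<^esub> = \<top>\<^bsub>M\<^esub>"
  and hom_meet: "\<lbrakk>x \<in> carrier L; y \<in> carrier L\<rbrakk> \<Longrightarrow> f (x \<sqinter>\<^bsub>L\<^esub> y) = f x \<sqinter>\<^bsub>M\<^esub> f y"
  and hom_Sup: "A \<subseteq> carrier L \<Longrightarrow> f (\<Squnion>\<^bsub>L\<^esub> A) = \<Squnion>\<^bsub>M\<^esub> (f ` A)"
  and hom_prox: "x \<prec>\<^bsub>L\<^esub> y \<Longrightarrow> f x \<prec>\<^bsub>M\<^esub> f y"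
  using hom by (auto simp: pf_hom_def)

lemma hom_join: "\<lbrakk>x \<in> carrier L; y \<in> carrier L\<rbrakk> \<Longrightarrow> f (x \<squnion>\<^bsub>L\<^esub> y) = f x \<squnion>\<^bsub>M\<^esub> f y"
  using hom_Sup[of "{x, y}"] by (simp add: join_def)

lemma hom_bottom: "f \<bottom>\<^bsub>L\<^esub> = \<bottom>\<^bsub>M\<^esub>"
  using hom_Sup[of "{}"] L.weak_sup_empty M.weak_sup_empty by (simp add: L.eq_is_equal M.eq_is_equal)

lemma hom_mono: "\<lbrakk>x \<in> carrier L; y \<in> carrier L; x \<sqsubseteq>\<^bsub>L\<^esub> y\<rbrakk> \<Longrightarrow> f x \<sqsubseteq>\<^bsub>M\<^esub> f y"
  by (metis L.le_iff_join M.meet_right closed hom_meet)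

text \<open>If \<open>a\<close> is below \<open>f b\<close> with \<open>b \<in> I\<close>, roundness
  gives \<open>c \<in> I\<close> with \<open>b\<close> proximal to \<open>c\<close>. Since
  \<open>f\<close> preserves proximities, \<open>a\<close> is then proximal to \<open>f c\<close>,
  so the order may replace the proximity.\<close>

lemma C_map_eq:
  assumes I: "round_ideal L I"
  shows "C_map L M f I = {a \<in> carrier M. \<exists>b\<in>I. a \<sqsubseteq>\<^bsub>M\<^esub> f b}"
proof -
  have "\<exists>c\<in>I. a \<prec>\<^bsub>M\<^esub> f c" if "a \<in> carrier M" "a \<sqsubseteq>\<^bsub>M\<^esub> f b" "b \<in> I" for a b
    using round_ideal_round[OF I that(3)] M.le_prox_trans[OF that(2) hom_prox that(1)] by blast
  then have "(\<exists>b\<in>I. a \<prec>\<^bsub>M\<^esub> f b) \<longleftrightarrow> (\<exists>b\<in>I. a \<sqsubseteq>\<^bsub>M\<^esub> f b)" if "a \<in> carrier M" for a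
    using that by (metis M.prox_le)
  then show ?thesis
    using I by (simp add: C_map_def round_map_def R_carrier cong: conj_cong)
qed

lemma image_mem_C_map:
  assumes I: "round_ideal L I" and b: "b \<in> I"
  shows "f b \<in> C_map L M f I"
proof -
  have "f b \<in> carrier M" using closed round_ideal_carrier[OF I b] by blast
  then show ?thesis using b by (auto simp: C_map_eq[OF I])
qed

lemma round_ideal_C_map:
  assumes I: "round_ideal L I"
  shows "round_ideal M (C_map L M f I)"
proof (rule round_idealI)
  show "\<bottom>\<^bsub>M\<^esub> \<in> C_map L M f I"
    using image_mem_C_map[OF I round_ideal_bottom[OF I]] by (simp add: hom_bottom)
  show "x \<squnion>\<^bsub>M\<^esub> y \<in> C_map L M f I" if xy: "x \<in> C_map L M f I" "y \<in> C_map L M f I" for x y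
  proof -
    obtain a b where ab: "a \<in> I" "b \<in> I" "x \<sqsubseteq>\<^bsub>M\<^esub> f a" "y \<sqsubseteq>\<^bsub>M\<^esub> f b" "x \<in> carrier M" "y \<in> carrier M"
      using xy I by (auto simp: C_map_eq)
    then have c: "a \<in> carrier L" "b \<in> carrier L" using round_ideal_carrier[OF I] by blast+
    have "x \<sqsubseteq>\<^bsub>M\<^esub> f a \<squnion>\<^bsub>M\<^esub> f b" "y \<sqsubseteq>\<^bsub>M\<^esub> f a \<squnion>\<^bsub>M\<^esub> f b"
      using ab c M.le_trans[OF _ M.join_left] M.le_trans[OF _ M.join_right] by (simp_all add: closed)
    then have "x \<squnion>\<^bsub>M\<^esub> y \<sqsubseteq>\<^bsub>M\<^esub> f (a \<squnion>\<^bsub>L\<^esub> b)"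
      using ab c by (simp add: hom_join closed M.join_le)
    then show ?thesis
      using I ab round_ideal_join[OF I ab(1,2)] by (auto simp: C_map_eq)
  qed
  show "y \<in> C_map L M f I" if xy: "x \<in> C_map L M f I" "y \<in> carrier M" "y \<sqsubseteq>\<^bsub>M\<^esub> x" for x y
  proof -
    obtain b where b: "b \<in> I" "x \<sqsubseteq>\<^bsub>M\<^esub> f b" "x \<in> carrier M" using xy(1) I by (auto simp: C_map_eq)
    then have "y \<sqsubseteq>\<^bsub>M\<^esub> f b"
      using xy(2,3) closed[OF round_ideal_carrier[OF I b(1)]] M.le_trans by blast
    then show ?thesis using I xy(2) b(1) by (auto simp: C_map_eq)
  qed
  \<comment> \<open>The original description by the proximity is used here: it provides
    \<open>b \<in> I\<close> with \<open>x\<close> proximal to \<open>f b\<close>, and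
    \<open>f b\<close> is itself a member.\<close>
  show "\<exists>y\<in>C_map L M f I. x \<prec>\<^bsub>M\<^esub> y" if "x \<in> C_map L M f I" for x
    using that I image_mem_C_map[OF I] by (auto simp: C_map_def round_map_def R_carrier)
qed (use I in \<open>simp add: C_map_eq\<close>)

text \<open>A downset has the same supremum as the set generating it, here the image of
  \<open>I\<close> under \<open>f\<close>, and \<open>f\<close> preserves suprema. The equation is
  the content of naturality of the counit.\<close>

lemma Sup_C_map:
  assumes I: "round_ideal L I"
  shows "\<Squnion>\<^bsub>M\<^esub> (C_map L M f I) = f (\<Squnion>\<^bsub>L\<^esub> I)"
proof (rule M.le_antisym)
  have R: "round_ideal M (C_map L M f I)" using I by (rule round_ideal_C_map)
  note sub = round_ideal_subset[OF I] round_ideal_subset[OF R]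
  show c: "\<Squnion>\<^bsub>M\<^esub> (C_map L M f I) \<in> carrier M" "f (\<Squnion>\<^bsub>L\<^esub> I) \<in> carrier M"
    using sub by (simp_all add: closed)
  have "x \<sqsubseteq>\<^bsub>M\<^esub> f (\<Squnion>\<^bsub>L\<^esub> I)" if x: "x \<in> C_map L M f I" for x
  proof -
    obtain b where b: "b \<in> I" "x \<sqsubseteq>\<^bsub>M\<^esub> f b" "x \<in> carrier M" using x I by (auto simp: C_map_eq)
    then have "f b \<sqsubseteq>\<^bsub>M\<^esub> f (\<Squnion>\<^bsub>L\<^esub> I)"
      using sub I by (auto intro!: hom_mono L.mem_le_Sup)
    then show ?thesis
      using b c sub closed M.le_trans by blast
  qed
  then show "\<Squnion>\<^bsub>M\<^esub> (C_map L M f I) \<sqsubseteq>\<^bsub>M\<^esub> f (\<Squnion>\<^bsub>L\<^esub> I)"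
    using sub c by (intro M.sup_least) auto
  have "f ` I \<subseteq> C_map L M f I" using image_mem_C_map[OF I] by blast
  then show "f (\<Squnion>\<^bsub>L\<^esub> I) \<sqsubseteq>\<^bsub>M\<^esub> \<Squnion>\<^bsub>M\<^esub> (C_map L M f I)"
    using sub by (simp add: hom_Sup M.Sup_mono)
qed

lemma C_map_mono: "\<lbrakk>round_ideal L I; round_ideal L J; I \<subseteq> J\<rbrakk> \<Longrightarrow> C_map L M f I \<subseteq> C_map L M f J"
  by (auto simp: C_map_eq)

text \<open>Since \<open>f\<close> preserves bottom, joins and order, it carries each generating
  step in \<open>L\<close> to one in \<open>M\<close>; downward closure extends this from images to
  all elements.\<close>

lemma C_map_span:
  assumes A: "\<And>I. I \<in> A \<Longrightarrow> round_ideal L I"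
  shows "C_map L M f (ideal_span L A) = ideal_span M (C_map L M f ` A)"
proof
  have S: "round_ideal L (ideal_span L A)" using A by (rule L.round_ideal_span)
  have S': "round_ideal M (ideal_span M (C_map L M f ` A))"
    using A by (auto intro!: M.round_ideal_span round_ideal_C_map)
  show "ideal_span M (C_map L M f ` A) \<subseteq> C_map L M f (ideal_span L A)"
  proof (rule ideal_span_least[OF round_ideal_C_map[OF S]])
    fix X assume "X \<in> C_map L M f ` A"
    then obtain I where "I \<in> A" "X = C_map L M f I" by blast
    then show "X \<subseteq> C_map L M f (ideal_span L A)"
      using C_map_mono[OF A S ideal_span_upper] by simp
  qed
  have "f b \<in> ideal_span M (C_map L M f ` A)" if "b \<in> ideal_span L A" for b
    using that
  proof induction
    case span_bottom
    show ?case by (simp add: hom_bottom ideal_span.span_bottom)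
  next
    case (span_base I x)
    then show ?case
      using image_mem_C_map[OF A] by (blast intro: ideal_span.span_base)
  next
    case (span_join x y)
    then show ?case
      using round_ideal_carrier[OF S] by (simp add: hom_join ideal_span.span_join)
  next
    case (span_down x y)
    then show ?case
      using round_ideal_carrier[OF S span_down.hyps(1)] ideal_span.span_down hom_mono closed by metis
  qed
  then show "C_map L M f (ideal_span L A) \<subseteq> ideal_span M (C_map L M f ` A)"
    using S round_ideal_down[OF S'] by (auto simp: C_map_eq)
qed

lemma C_map_hom: "C_map L M f \<in> pf_hom (\<C> L) (\<C> M)"
proof (rule pf_homI)
  show "C_map L M f \<in> carrier (\<C> L) \<rightarrow>\<^sub>E carrier (\<C> M)"
    using C_map_extensional[of L M f] by (auto simp: PiE_iff round_ideal_C_map)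
  have "\<top>\<^bsub>M\<^esub> \<in> C_map L M f (carrier L)"
    using image_mem_C_map[OF L.round_ideal_carrier_set L.top_closed] by (simp add: hom_top)
  then have "carrier M \<subseteq> C_map L M f (carrier L)"
    using round_ideal_down[OF round_ideal_C_map[OF L.round_ideal_carrier_set]] M.top_higher by blast
  then show "C_map L M f \<top>\<^bsub>\<C> L\<^esub> = \<top>\<^bsub>\<C> M\<^esub>"
    using round_ideal_subset[OF round_ideal_C_map[OF L.round_ideal_carrier_set]]
    by (simp add: L.C_top M.C_top subset_antisym)
  show "C_map L M f (I \<sqinter>\<^bsub>\<C> L\<^esub> J) = C_map L M f I \<sqinter>\<^bsub>\<C> M\<^esub> C_map L M f J"
    if "I \<in> carrier (\<C> L)" "J \<in> carrier (\<C> L)" for I J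
  proof -
    have I: "round_ideal L I" and J: "round_ideal L J" using that by auto
    note IJ = L.round_ideal_Int[OF I J]
    \<comment> \<open>The separate bounds \<open>f a\<close> and \<open>f b\<close> combine into the
      single bound \<open>f (a \<sqinter> b)\<close>, whose argument lies in
      \<open>I \<inter> J\<close>.\<close>
    have "x \<in> C_map L M f (I \<inter> J)" if x: "x \<in> C_map L M f I" "x \<in> C_map L M f J" for x
    proof -
      obtain a b where ab: "a \<in> I" "b \<in> J" "x \<sqsubseteq>\<^bsub>M\<^esub> f a" "x \<sqsubseteq>\<^bsub>M\<^esub> f b" and xc: "x \<in> carrier M"
        using x I J by (auto simp: C_map_eq)
      then have "a \<in> carrier L" "b \<in> carrier L"
        using I J by (simp_all add: round_ideal_carrier)
      then have "x \<sqsubseteq>\<^bsub>M\<^esub> f (a \<sqinter>\<^bsub>L\<^esub> b)"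
        using ab xc by (simp add: hom_meet closed M.meet_le)
      then show ?thesis
        using L.meet_mem_Int[OF I J ab(1,2)] xc IJ by (auto simp: C_map_eq)
    qed
    moreover have "C_map L M f (I \<inter> J) \<subseteq> C_map L M f I \<inter> C_map L M f J"
      using C_map_mono[OF IJ I] C_map_mono[OF IJ J] by simp
    ultimately show ?thesis
      using I J round_ideal_C_map L.C_meet M.C_meet by auto
  qed
  show "C_map L M f (\<Squnion>\<^bsub>\<C> L\<^esub> A) = \<Squnion>\<^bsub>\<C> M\<^esub> (C_map L M f ` A)" if "A \<subseteq> carrier (\<C> L)" for A
  proof -
    have A: "\<And>I. I \<in> A \<Longrightarrow> round_ideal L I" using that by auto
    then have "\<And>X. X \<in> C_map L M f ` A \<Longrightarrow> round_ideal M X" using round_ideal_C_map by blast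
    from M.C_Sup[OF this] show ?thesis
      using L.C_Sup[OF A] C_map_span[OF A] by simp
  qed
  show "C_map L M f I \<prec>\<^bsub>\<C> M\<^esub> C_map L M f J" if "I \<prec>\<^bsub>\<C> L\<^esub> J" for I J
    using that by (simp add: L.C_prox M.C_prox round_ideal_C_map Sup_C_map hom_prox C_map_mono)
qed

lemma counit_natural: "pf_comp (\<C> L) (counit M) (C_map L M f) = pf_comp (\<C> L) f (counit L)"
  by (rule pf_comp_C_eqI)
    (simp_all add: pf_comp_C counit_eq round_ideal_C_map Sup_C_map pf_comp_C_extensional)

lemma pf_morphism_C_map: "pf_morphism (\<C> L) (\<C> M) (C_map L M f)"
  by (intro pf_morphism.intro pf_morphism_axioms.intro L.proximity_frame_C M.proximity_frame_C C_map_hom)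

text \<open>Evaluated at \<open>I\<close>, the left side asks for \<open>\<Squnion>K\<close> below
  \<open>f b\<close> with \<open>b \<in> I\<close>, the right side for
  \<open>K \<subseteq> C_map L M f J\<close> with \<open>\<Squnion>J \<in> I\<close>. Taking suprema
  leads from right to left by \<open>Sup_C_map\<close>.\<close>

lemma comult_natural:
  "pf_comp (\<C> L) (comult M) (C_map L M f) =
   pf_comp (\<C> L) (C_map (\<C> L) (\<C> M) (C_map L M f)) (comult L)"
proof (rule pf_comp_C_eqI)
  interpret C: pf_morphism "\<C> L" "\<C> M" "C_map L M f" by (rule pf_morphism_C_map)
  fix I assume I: "round_ideal L I"
  have "K \<in> comult M (C_map L M f I) \<longleftrightarrow>
      K \<in> C_map (\<C> L) (\<C> M) (C_map L M f) (comult L I)" if K: "round_ideal M K" for K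
  proof
    assume "K \<in> comult M (C_map L M f I)"
    then have "\<Squnion>\<^bsub>M\<^esub> K \<in> C_map L M f I"
      by (simp add: M.comult_eq[OF round_ideal_C_map[OF I]])
    then obtain b where b: "b \<in> I" "\<Squnion>\<^bsub>M\<^esub> K \<sqsubseteq>\<^bsub>M\<^esub> f b"
      by (auto simp: C_map_eq[OF I])
    \<comment> \<open>The ideal \<open>J\<close> sought must contain \<open>b\<close> itself, so
      roundness is used to pass to some \<open>a \<in> I\<close> with
      \<open>b \<in> \<kappa> L a\<close>; then \<open>J = \<kappa> L a\<close>.\<close>
    obtain a where a: "a \<in> I" "b \<in> \<kappa> L a" using L.mem_kappa_mem[OF I b(1)] by blast
    have ka: "round_ideal L (\<kappa> L a)"
      using round_ideal_carrier[OF I a(1)] by (rule L.round_ideal_kappa)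
    have "\<Squnion>\<^bsub>M\<^esub> K \<in> C_map L M f (\<kappa> L a)"
      using round_ideal_down[OF round_ideal_C_map[OF ka] image_mem_C_map[OF ka a(2)]] b(2)
        M.Sup_round_carrier[OF K] by blast
    then have "K \<subseteq> C_map L M f (\<kappa> L a)"
      using round_ideal_down[OF round_ideal_C_map[OF ka]] M.mem_le_Sup[OF K] round_ideal_carrier[OF K] by blast
    then show "K \<in> C_map (\<C> L) (\<C> M) (C_map L M f) (comult L I)"
      using K L.kappa_mem_comult[OF I a(1)] by (auto simp: C.C_map_eq[OF L.round_ideal_comult[OF I]])
  next
    assume "K \<in> C_map (\<C> L) (\<C> M) (C_map L M f) (comult L I)"
    then obtain J where J: "J \<in> comult L I" "K \<subseteq> C_map L M f J"
      by (auto simp: C.C_map_eq[OF L.round_ideal_comult[OF I]])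
    then have RJ: "round_ideal L J" "\<Squnion>\<^bsub>L\<^esub> J \<in> I" using I by (simp_all add: L.comult_eq)
    then have "\<Squnion>\<^bsub>M\<^esub> K \<sqsubseteq>\<^bsub>M\<^esub> f (\<Squnion>\<^bsub>L\<^esub> J)"
      using M.Sup_mono[OF J(2)] round_ideal_subset[OF round_ideal_C_map] by (simp add: Sup_C_map)
    then have "\<Squnion>\<^bsub>M\<^esub> K \<in> C_map L M f I"
      using RJ(2) M.Sup_round_carrier[OF K] by (auto simp: C_map_eq[OF I])
    then show "K \<in> comult M (C_map L M f I)"
      using K by (simp add: M.comult_eq[OF round_ideal_C_map[OF I]])
  qed
  moreover have "comult M (C_map L M f I) \<subseteq> {K. round_ideal M K}"
    "C_map (\<C> L) (\<C> M) (C_map L M f) (comult L I) \<subseteq> {K. round_ideal M K}"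
    using M.comult_eq[OF round_ideal_C_map[OF I]] C.C_map_eq[OF L.round_ideal_comult[OF I]] by auto
  ultimately show "comult M (C_map L M f I) =
      pf_comp (\<C> L) (C_map (\<C> L) (\<C> M) (C_map L M f)) (comult L) I"
    using I by (auto simp: pf_comp_C)
qed (rule pf_comp_C_extensional)

end

section \<open>Functor laws\<close>

lemma pf_morphismI: "\<lbrakk>proximity_frame L; proximity_frame M; f \<in> pf_hom L M\<rbrakk> \<Longrightarrow> pf_morphism L M f"
  by (simp add: pf_morphism.intro pf_morphism_axioms.intro)

text \<open>In terms of generated downsets: a bound \<open>g c\<close> with \<open>c\<close> below
  \<open>f b\<close> is improved to \<open>g (f b)\<close> by monotonicity, and conversely
  \<open>c = f b\<close> is a member of the intermediate ideal.\<close>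

lemma C_map_comp:
  assumes "pf_morphism L M f" "pf_morphism M N g"
  shows "C_map L N (pf_comp L g f) = pf_comp (\<C> L) (C_map M N g) (C_map L M f)"
proof (rule pf_comp_C_eqI[symmetric, OF _ C_map_extensional])
  interpret f: pf_morphism L M f by fact
  interpret g: pf_morphism M N g by fact
  interpret gf: pf_morphism L N "pf_comp L g f"
    by (intro pf_morphismI pf_comp_hom[OF _ f.hom g.hom] f.L.proximity_frame_axioms g.M.proximity_frame_axioms)
  fix I assume I: "round_ideal L I"
  have app: "pf_comp L g f b = g (f b)" if "b \<in> I" for b
    using round_ideal_carrier[OF I that] by (simp add: pf_comp_def compose_def)
  show "C_map M N g (C_map L M f I) = C_map L N (pf_comp L g f) I"
  proof
    show "C_map M N g (C_map L M f I) \<subseteq> C_map L N (pf_comp L g f) I"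
    proof
      fix a assume "a \<in> C_map M N g (C_map L M f I)"
      then obtain c where c: "a \<in> carrier N" "a \<sqsubseteq>\<^bsub>N\<^esub> g c" "c \<in> C_map L M f I"
        by (auto simp: g.C_map_eq[OF f.round_ideal_C_map[OF I]])
      then obtain b where b: "b \<in> I" "c \<in> carrier M" "c \<sqsubseteq>\<^bsub>M\<^esub> f b"
        by (auto simp: f.C_map_eq[OF I])
      have fb: "f b \<in> carrier M" using f.closed round_ideal_carrier[OF I b(1)] by blast
      have "a \<sqsubseteq>\<^bsub>N\<^esub> pf_comp L g f b"
        unfolding app[OF b(1)]
        using c(2) g.hom_mono[OF b(2) fb b(3)] c(1) g.closed[OF b(2)] g.closed[OF fb]
        by (rule g.M.le_trans)
      then show "a \<in> C_map L N (pf_comp L g f) I"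
        using c(1) b(1) by (auto simp: gf.C_map_eq[OF I])
    qed
    show "C_map L N (pf_comp L g f) I \<subseteq> C_map M N g (C_map L M f I)"
      unfolding g.C_map_eq[OF f.round_ideal_C_map[OF I]] gf.C_map_eq[OF I]
      by (auto simp: app intro: f.image_mem_C_map[OF I])
  qed
qed

context proximity_frame
begin

lemma C_map_id: "C_map L L (pf_id L) = pf_id (\<C> L)"
proof -
  interpret pf_morphism L L "pf_id L"
    by (intro pf_morphismI pf_id_hom proximity_frame_axioms)
  have "C_map L L (pf_id L) I = I" if I: "round_ideal L I" for I
  proof
    have id: "pf_id L b = b" if "b \<in> I" for b
      using round_ideal_carrier[OF I that] by (simp add: pf_id_def)
    then show "I \<subseteq> C_map L L (pf_id L) I"
      using image_mem_C_map[OF I] by force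
    show "C_map L L (pf_id L) I \<subseteq> I"
      using round_ideal_down[OF I] by (auto simp: C_map_eq[OF I] id)
  qed
  then show ?thesis
    using C_map_extensional[of L L "pf_id L"] pf_id_C_extensional[of L]
    by (intro extensionalityI[of _ "{I. round_ideal L I}"]) (simp_all add: pf_id_C)
qed

section \<open>Comonad laws\<close>

lemma counit_comult: "pf_comp (\<C> L) (counit (\<C> L)) (comult L) = pf_id (\<C> L)"
  by (rule pf_comp_C_eqI)
    (simp_all add: counit_eq round_ideal_comult C_Sup_comult pf_id_C pf_id_C_extensional)

text \<open>The counit sends the members of \<open>comult L I\<close> to their suprema, which lie in
  \<open>I\<close>; every \<open>a \<in> I\<close> arises in this way from
  \<open>\<kappa> L a\<close>.\<close>

lemma C_map_counit_comult: "pf_comp (\<C> L) (C_map (\<C> L) L (counit L)) (comult L) = pf_id (\<C> L)"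
proof (rule pf_comp_C_eqI[OF _ pf_id_C_extensional])
  interpret pf_morphism "\<C> L" L "counit L"
    by (intro pf_morphismI proximity_frame_C counit_hom proximity_frame_axioms)
  fix I assume I: "round_ideal L I"
  have "a \<in> C_map (\<C> L) L (counit L) (comult L I)" if "a \<in> I" for a
    using image_mem_C_map[OF round_ideal_comult[OF I] kappa_mem_comult[OF I that]]
      round_ideal_carrier[OF I that] by (simp add: counit_eq round_ideal_kappa Sup_kappa)
  moreover have "C_map (\<C> L) L (counit L) (comult L I) \<subseteq> I"
    unfolding C_map_eq[OF round_ideal_comult[OF I]]
    using round_ideal_down[OF I] by (auto simp: comult_eq[OF I] counit_eq)
  ultimately show "C_map (\<C> L) L (counit L) (comult L I) = pf_id (\<C> L) I"
    using I by (auto simp: pf_id_C)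
qed

text \<open>At \<open>I\<close> the two sides ask for \<open>K \<in> comult L I\<close> with
  \<open>X \<subseteq> comult L K\<close>, respectively for the supremum of \<open>X\<close> to be
  in \<open>comult L I\<close>. Given \<open>K\<close>, that supremum lies inside \<open>K\<close>
  by \<open>C_Sup_comult\<close>.\<close>

lemma comult_coassoc:
  "pf_comp (\<C> L) (C_map (\<C> L) (\<C> (\<C> L)) (comult L)) (comult L) =
   pf_comp (\<C> L) (comult (\<C> L)) (comult L)"
proof (rule pf_comp_C_eqI[OF _ pf_comp_C_extensional])
  interpret C: proximity_frame "\<C> L" by (rule proximity_frame_C)
  interpret pf_morphism "\<C> L" "\<C> (\<C> L)" "comult L"
    by (intro pf_morphismI proximity_frame_C C.proximity_frame_C comult_hom)
  fix I assume I: "round_ideal L I"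
  note cI = round_ideal_comult[OF I]
  have "(\<exists>K\<in>comult L I. X \<subseteq> comult L K) \<longleftrightarrow> \<Squnion>\<^bsub>\<C> L\<^esub> X \<in> comult L I"
    if X: "round_ideal (\<C> L) X" for X
  proof
    assume "\<exists>K\<in>comult L I. X \<subseteq> comult L K"
    then obtain K where K: "K \<in> comult L I" "X \<subseteq> comult L K" by blast
    then have "round_ideal L K" using I by (simp add: comult_eq)
    then have "\<Squnion>\<^bsub>\<C> L\<^esub> X \<subseteq> K"
      using C.Sup_mono[OF K(2)] C_Sup_comult round_ideal_subset[OF round_ideal_comult] by simp
    then show "\<Squnion>\<^bsub>\<C> L\<^esub> X \<in> comult L I"
      using round_ideal_down[OF cI K(1)] C.Sup_round_carrier[OF X] by simp
  next
    assume "\<Squnion>\<^bsub>\<C> L\<^esub> X \<in> comult L I"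
    then have S: "round_ideal L (\<Squnion>\<^bsub>\<C> L\<^esub> X)" "\<Squnion>(\<Squnion>\<^bsub>\<C> L\<^esub> X) \<in> I" using I by (simp_all add: comult_eq)
    \<comment> \<open>The choice is \<open>K = \<kappa> L b\<close>, with \<open>b\<close> picked by
      roundness so that \<open>K\<close> contains the iterated supremum of \<open>X\<close> and with
      it \<open>\<Squnion>Y\<close> for every \<open>Y \<in> X\<close>.\<close>
    then obtain b where b: "b \<in> I" "\<Squnion>(\<Squnion>\<^bsub>\<C> L\<^esub> X) \<in> \<kappa> L b" using mem_kappa_mem[OF I] by blast
    have kb: "round_ideal L (\<kappa> L b)" using round_ideal_carrier[OF I b(1)] by (rule round_ideal_kappa)
    have "Y \<in> comult L (\<kappa> L b)" if Y: "Y \<in> X" for Y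
    proof -
      have RY: "round_ideal L Y" using round_ideal_carrier[OF X Y] by simp
      have "Y \<subseteq> \<Squnion>\<^bsub>\<C> L\<^esub> X" using C.mem_le_Sup[OF X Y] by simp
      then have "\<Squnion>Y \<sqsubseteq> \<Squnion>(\<Squnion>\<^bsub>\<C> L\<^esub> X)" using Sup_mono round_ideal_subset[OF S(1)] by blast
      then show ?thesis
        using round_ideal_down[OF kb b(2)] RY Sup_round_carrier[OF RY] by (simp add: comult_eq kb)
    qed
    then show "\<exists>K\<in>comult L I. X \<subseteq> comult L K"
      using kappa_mem_comult[OF I b(1)] by blast
  qed
  then show "C_map (\<C> L) (\<C> (\<C> L)) (comult L) (comult L I) =
      pf_comp (\<C> L) (comult (\<C> L)) (comult L) I"
    using I by (auto simp: pf_comp_C C_map_eq[OF cI] C.comult_eq[OF cI])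
qed

end

theorem theorem4p19:
  shows
    "((\<forall>L :: 'a prox_frame. proximity_frame L \<longrightarrow> proximity_frame (\<C> L)) \<and>
      (\<forall>(L :: 'a prox_frame) (M :: 'b prox_frame) f.
         proximity_frame L \<and> proximity_frame M \<and> f \<in> pf_hom L M \<longrightarrow>
         C_map L M f \<in> pf_hom (\<C> L) (\<C> M)) \<and>
      (\<forall>L :: 'a prox_frame. proximity_frame L \<longrightarrow> C_map L L (pf_id L) = pf_id (\<C> L)) \<and>
      (\<forall>(L :: 'a prox_frame) (M :: 'b prox_frame) (N :: 'c prox_frame) f g.
         proximity_frame L \<and> proximity_frame M \<and> proximity_frame N \<and>
         f \<in> pf_hom L M \<and> g \<in> pf_hom M N \<longrightarrow>
         C_map L N (pf_comp L g f) = pf_comp (\<C> L) (C_map M N g) (C_map L M f)))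
   \<and> ((\<forall>L :: 'a prox_frame. proximity_frame L \<longrightarrow> counit L \<in> pf_hom (\<C> L) L) \<and>
      (\<forall>(L :: 'a prox_frame) (M :: 'b prox_frame) f.
         proximity_frame L \<and> proximity_frame M \<and> f \<in> pf_hom L M \<longrightarrow>
         pf_comp (\<C> L) (counit M) (C_map L M f) = pf_comp (\<C> L) f (counit L)))
   \<and> ((\<forall>L :: 'a prox_frame. proximity_frame L \<longrightarrow> comult L \<in> pf_hom (\<C> L) (\<C> (\<C> L))) \<and>
      (\<forall>(L :: 'a prox_frame) (M :: 'b prox_frame) f.
         proximity_frame L \<and> proximity_frame M \<and> f \<in> pf_hom L M \<longrightarrow>
         pf_comp (\<C> L) (comult M) (C_map L M f) =
         pf_comp (\<C> L) (C_map (\<C> L) (\<C> M) (C_map L M f)) (comult L)))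
   \<and> (\<forall>L :: 'a prox_frame. proximity_frame L \<longrightarrow>
         pf_comp (\<C> L) (C_map (\<C> L) (\<C> (\<C> L)) (comult L)) (comult L) =
         pf_comp (\<C> L) (comult (\<C> L)) (comult L) \<and>
         pf_comp (\<C> L) (counit (\<C> L)) (comult L) = pf_id (\<C> L) \<and>
         pf_comp (\<C> L) (C_map (\<C> L) L (counit L)) (comult L) = pf_id (\<C> L))"
  by (intro conjI allI impI)
    (blast intro: pf_morphismI C_map_comp pf_morphism.C_map_hom pf_morphism.counit_natural
      pf_morphism.comult_natural proximity_frame.proximity_frame_C proximity_frame.C_map_id
      proximity_frame.counit_hom proximity_frame.comult_hom proximity_frame.comult_coassoc
      proximity_frame.counit_comult proximity_frame.C_map_counit_comult)+

end
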